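(* Let $\mathcal{A}$ be a monounary algebra. Then the following are equivalent: (1) $\mathcal{A}$ is partially homogeneous; (2) $\mathcal{A}$ is partially $1$-homogeneous and partially $2$-homogeneous; (3) $\mathcal{A}^*$ is ultrahomogeneous; (4) $\mathcal{A}^*$ is $2$-ultrahomogeneous; (5) $\mathcal{A}$ is isomorphic to one of: (i) $\alpha\cdot\mathcal{Z}_1+\beta\cdot\mathcal{Z}_2$ for some cardinals $\alpha,\beta$; (ii) $\alpha\cdot\mathcal{Z}_1+\beta\cdot\mathcal{Z}_3$ for some cardinals $\alpha,\beta$; (iii) $\alpha\cdot\mathcal{Z}_1+\mathcal{Z}_4$ for some cardinal $\alpha$; (iv) $\alpha\cdot\mathcal{A}[1;1]$ for some cardinal $\alpha$; (v) $\mathcal{A}[1;\alpha]$ for some cardinal $\alpha$. In particular, if $\mathcal{A}^*$ is ultrahomogeneous then $\mathcal{A}$ is ultrahomogeneous.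
   Context: A monounary algebra is a pair $\mathcal{A}=(A;\theta)$ where $A$ is a nonempty set (of arbitrary cardinality) and $\theta\colon A\to A$. Each nonempty $B\subseteq A$ gives a partial subalgebra $\mathcal{B}=(B;\theta_B)$ with $\mathrm{dom}(\theta_B)=\{b\in B:\theta(b)\in B\}$ and $\theta_B(b)=\theta(b)$ on its domain; it is a subalgebra if $\mathrm{dom}(\theta_B)=B$. An isomorphism between partial monounary algebras $(B;\theta)$ and $(B';\theta')$ is a bijection $\phi\colon B\to B'$ such that $x\in\mathrm{dom}(\theta)$ if and only if $\phi(x)\in\mathrm{dom}(\theta')$, and then $\phi(\theta(x))=\theta'(\phi(x))$. An automorphism of $\mathcal{A}$ is an isomorphism of $\mathcal{A}$ with itself. $\mathcal{A}$ is partially $n$-homogeneous if every isomorphism between partial subalgebras of $\mathcal{A}$ of size $n$ extends to an automorphism of $\mathcal{A}$; it is partially homogeneous if this holds for every $n\geq 1$. The relational form of $\mathcal{A}$ is the digraph $\mathcal{A}^*=(A;R_\theta)$ with $(x,y)\in R_\theta$ iff $\theta(x)=y$ (loops allowed). A structure $\mathcal{M}$ is $n$-ultrahomogeneous if every isomorphism between substructures generated by $n$ elements (not necessarily distinct) extends to an automorphism of $\mathcal{M}$, and ultrahomogeneous if it is $n$-ultrahomogeneous for every $n\geq 1$. (For $\mathcal{A}^*$, substructures are induced subdigraphs; for $\mathcal{A}$, they are subalgebras.) $\mathcal{Z}_n$ is the $n$-cycle $(\{0,\dots,n-1\};\, i\mapsto i+1 \bmod n)$. $+$ is disjoint union and $\alpha\cdot\mathcal{C}$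 is the disjoint union of $\alpha$ copies of $\mathcal{C}$ (cardinals may be $0$, giving an empty summand). $\mathcal{A}[1;\alpha]$ is the monounary algebra consisting of a single fixed point $c$ of $\theta$ together with $\alpha$ further elements, all mapped to $c$ by $\theta$ (these having no preimages). *)

theory Defs
  imports Main
begin

text \<open>
  Total and partial monounary algebras share one type: the operation matters only on the set
  \<open>domain\<close>, and its values elsewhere are junk that no notion below looks at.
\<close>

record 'a partial_monounary =
  carrier :: "'a set"
  domain :: "'a set"
  oper :: "'a \<Rightarrow> 'a"

definition monounary_algebra :: "'a partial_monounary \<Rightarrow> bool" where
  "monounary_algebra M \<longleftrightarrow>
     carrier M \<noteq> {} \<and> domain M = carrier M \<and> (\<forall>x\<in>carrier M. oper M x \<in> carrier M)"

definition partial_subalgebra :: "'a partial_monounary \<Rightarrow> 'a set \<Rightarrow> 'a partial_monounary" where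
  "partial_subalgebra M B =
     \<lparr>carrier = B, domain = {b \<in> B. b \<in> domain M \<and> oper M b \<in> B}, oper = oper M\<rparr>"

definition is_subalgebra :: "'a partial_monounary \<Rightarrow> 'a set \<Rightarrow> bool" where
  "is_subalgebra M B \<longleftrightarrow>
     B \<noteq> {} \<and> B \<subseteq> carrier M \<and> domain (partial_subalgebra M B) = B"

definition isomorphism ::
    "'a partial_monounary \<Rightarrow> 'b partial_monounary \<Rightarrow> ('a \<Rightarrow> 'b) \<Rightarrow> bool" where
  "isomorphism M N \<phi> \<longleftrightarrow>
     bij_betw \<phi> (carrier M) (carrier N) \<and>
     (\<forall>x\<in>carrier M. x \<in> domain M \<longleftrightarrow> \<phi> x \<in> domain N) \<and>
     (\<forall>x\<in>domain M. \<phi> (oper M x) = oper N (\<phi> x))"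

definition isomorphic :: "'a partial_monounary \<Rightarrow> 'b partial_monounary \<Rightarrow> bool" where
  "isomorphic M N \<longleftrightarrow> (\<exists>\<phi>. isomorphism M N \<phi>)"

definition automorphism :: "'a partial_monounary \<Rightarrow> ('a \<Rightarrow> 'a) \<Rightarrow> bool" where
  "automorphism M \<phi> \<longleftrightarrow> isomorphism M M \<phi>"

definition partially_n_homogeneous :: "nat \<Rightarrow> 'a partial_monounary \<Rightarrow> bool" where
  "partially_n_homogeneous n M \<longleftrightarrow>
     (\<forall>B C \<phi>. B \<noteq> {} \<and> B \<subseteq> carrier M \<and> finite B \<and> card B = n \<and>
              C \<noteq> {} \<and> C \<subseteq> carrier M \<and> finite C \<and> card C = n \<and>
              isomorphism (partial_subalgebra M B) (partial_subalgebra M C) \<phi>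
        \<longrightarrow> (\<exists>\<psi>. automorphism M \<psi> \<and> (\<forall>x\<in>B. \<psi> x = \<phi> x)))"

definition partially_homogeneous :: "'a partial_monounary \<Rightarrow> bool" where
  "partially_homogeneous M \<longleftrightarrow> (\<forall>n\<ge>1. partially_n_homogeneous n M)"


text \<open>
  In both definitions of \<open>n\<close>-ultrahomogeneity the \<open>n\<close> generators, which need not be distinct,
  are the entries of a list of length \<open>n\<close>.
\<close>

definition generated :: "'a partial_monounary \<Rightarrow> 'a set \<Rightarrow> 'a set" where
  "generated M X = \<Inter>{S. is_subalgebra M S \<and> X \<subseteq> S}"

definition n_ultrahomogeneous :: "nat \<Rightarrow> 'a partial_monounary \<Rightarrow> bool" where
  "n_ultrahomogeneous n M \<longleftrightarrow>
     (\<forall>xs ys \<phi>. length xs = n \<and> set xs \<subseteq> carrier M \<and>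
                length ys = n \<and> set ys \<subseteq> carrier M \<and>
                isomorphism (partial_subalgebra M (generated M (set xs)))
                            (partial_subalgebra M (generated M (set ys))) \<phi>
        \<longrightarrow> (\<exists>\<psi>. automorphism M \<psi> \<and> (\<forall>x\<in>generated M (set xs). \<psi> x = \<phi> x)))"

definition ultrahomogeneous :: "'a partial_monounary \<Rightarrow> bool" where
  "ultrahomogeneous M \<longleftrightarrow> (\<forall>n\<ge>1. n_ultrahomogeneous n M)"


record 'a digraph =
  verts :: "'a set"
  arcs :: "('a \<times> 'a) set"

definition relational_form :: "'a partial_monounary \<Rightarrow> 'a digraph" where
  "relational_form M =
     \<lparr>verts = carrier M,
      arcs = {(x, y). x \<in> carrier M \<and> y \<in> carrier M \<and> x \<in> domain M \<and> oper M x = y}\<rparr>"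

definition induced_subdigraph :: "'a digraph \<Rightarrow> 'a set \<Rightarrow> 'a digraph" where
  "induced_subdigraph G B = \<lparr>verts = B, arcs = arcs G \<inter> B \<times> B\<rparr>"

definition digraph_isomorphism :: "'a digraph \<Rightarrow> 'b digraph \<Rightarrow> ('a \<Rightarrow> 'b) \<Rightarrow> bool" where
  "digraph_isomorphism G H \<phi> \<longleftrightarrow>
     bij_betw \<phi> (verts G) (verts H) \<and>
     (\<forall>x\<in>verts G. \<forall>y\<in>verts G. (x, y) \<in> arcs G \<longleftrightarrow> (\<phi> x, \<phi> y) \<in> arcs H)"

definition digraph_automorphism :: "'a digraph \<Rightarrow> ('a \<Rightarrow> 'a) \<Rightarrow> bool" where
  "digraph_automorphism G \<phi> \<longleftrightarrow> digraph_isomorphism G G \<phi>"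

text \<open>The signature is relational, so a set of vertices generates just the subdigraph it induces.\<close>

definition digraph_n_ultrahomogeneous :: "nat \<Rightarrow> 'a digraph \<Rightarrow> bool" where
  "digraph_n_ultrahomogeneous n G \<longleftrightarrow>
     (\<forall>xs ys \<phi>. length xs = n \<and> set xs \<subseteq> verts G \<and>
                length ys = n \<and> set ys \<subseteq> verts G \<and>
                digraph_isomorphism (induced_subdigraph G (set xs))
                                    (induced_subdigraph G (set ys)) \<phi>
        \<longrightarrow> (\<exists>\<psi>. digraph_automorphism G \<psi> \<and> (\<forall>x\<in>set xs. \<psi> x = \<phi> x)))"

definition digraph_ultrahomogeneous :: "'a digraph \<Rightarrow> bool" where
  "digraph_ultrahomogeneous G \<longleftrightarrow> (\<forall>n\<ge>1. digraph_n_ultrahomogeneous n G)"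


definition cycle_algebra :: "nat \<Rightarrow> nat partial_monounary" where
  "cycle_algebra n = \<lparr>carrier = {..<n}, domain = {..<n}, oper = (\<lambda>i. (i + 1) mod n)\<rparr>"

definition disjoint_sum ::
    "'a partial_monounary \<Rightarrow> 'b partial_monounary \<Rightarrow> ('a + 'b) partial_monounary" where
  "disjoint_sum M N =
     \<lparr>carrier = carrier M <+> carrier N,
      domain = domain M <+> domain N,
      oper = map_sum (oper M) (oper N)\<rparr>"

text \<open>Here and in \<open>star_algebra\<close> a cardinal is given by an index set of that cardinality.
  If such an algebra is isomorphic to an algebra over the type \<open>'a\<close>, the cardinals involved
  are at most the cardinality of \<open>'a\<close>, so quantifying over index sets of type \<open>'a set\<close>
  covers all of them.\<close>

definition copies :: "'i set \<Rightarrow> 'a partial_monounary \<Rightarrow> ('i \<times> 'a) partial_monounary" where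
  "copies I M =
     \<lparr>carrier = I \<times> carrier M, domain = I \<times> domain M, oper = map_prod id (oper M)\<rparr>"

text \<open>
  \<open>\<A>[1;\<alpha>]\<close> with \<open>\<alpha> = |I|\<close>: the fixed point is \<open>None\<close>, and the further elements are
  \<open>Some i\<close> for \<open>i \<in> I\<close>.
\<close>

definition star_algebra :: "'i set \<Rightarrow> 'i option partial_monounary" where
  "star_algebra I =
     \<lparr>carrier = insert None (Some ` I), domain = insert None (Some ` I), oper = (\<lambda>_. None)\<rparr>"

end

theory Submission
  imports Defs
begin

text \<open>
  Partial isomorphisms of \<open>\<A>\<close> are exactly isomorphisms between induced subdigraphs of \<open>\<A>\<^sup>*\<close>,
  so both kinds of homogeneity coincide, and it remains to classify the homogeneous operations \<open>f\<close>.

  Partial \<open>1\<close>-homogeneity makes all non-fixed points \<open>x\<close> look alike. If \<open>f x\<close> is fixed, then \<open>f\<close>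
  is constant, or there are two fixed points; a fixed point with two proper preimages \<open>y\<close>, \<open>z\<close> is
  then excluded by moving \<open>(y, z)\<close> to \<open>(y, w)\<close> with \<open>w\<close> over another fixed point. If \<open>f x\<close> is not
  fixed and neither \<open>f\<^sup>2 x = x\<close> nor \<open>f\<^sup>3 x = x\<close>, then swapping the non-adjacent \<open>x\<close> and
  \<open>f\<^sup>2 x\<close> gives \<open>f\<^sup>4 x = x\<close>, and a non-fixed \<open>y\<close> off this cycle is excluded by moving \<open>(x, y)\<close> to
  \<open>(x, f\<^sup>2 x)\<close>.

  Conversely, in each listed algebra a partial isomorphism is extended one point at a time. That
  reduces the claim to moving a point \<open>b\<close> to a point \<open>c\<close> of the same type over a set \<open>B\<close> while
  fixing \<open>B\<close>; swapping the components of \<open>b\<close> and \<open>c\<close>, or rotating their common cycle, does this.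
\<close>

section \<open>Automorphisms and homogeneity of a total operation\<close>

locale unary_operation =
  fixes A :: "'a set" and f :: "'a \<Rightarrow> 'a"
  assumes closed: "x \<in> A \<Longrightarrow> f x \<in> A"
begin

definition auto :: "('a \<Rightarrow> 'a) \<Rightarrow> bool" where
  "auto \<psi> \<longleftrightarrow> bij_betw \<psi> A A \<and> (\<forall>x\<in>A. \<psi> (f x) = f (\<psi> x))"

text \<open>For injective \<open>\<phi>\<close> this makes \<open>\<phi>\<close> an isomorphism from
  the subdigraph induced on \<open>B\<close> onto the one induced on its image. Partial domains do
  not occur, so the partial algebra and the digraph notions can both be reduced to it.\<close>

definition arc_preserving :: "'a set \<Rightarrow> ('a \<Rightarrow> 'a) \<Rightarrow> bool" where
  "arc_preserving B \<phi> \<longleftrightarrow> (\<forall>x\<in>B. \<forall>y\<in>B. f x = y \<longleftrightarrow> f (\<phi> x) = \<phi> y)"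

definition homogeneous :: "nat \<Rightarrow> bool" where
  "homogeneous n \<longleftrightarrow>
     (\<forall>B \<phi>. finite B \<and> card B = n \<and> B \<subseteq> A \<and> inj_on \<phi> B \<and> \<phi> ` B \<subseteq> A \<and> arc_preserving B \<phi>
        \<longrightarrow> (\<exists>\<psi>. auto \<psi> \<and> (\<forall>x\<in>B. \<psi> x = \<phi> x)))"

lemma auto_in: "auto \<psi> \<Longrightarrow> x \<in> A \<Longrightarrow> \<psi> x \<in> A"
  by (auto simp: auto_def bij_betw_def)

lemma auto_f: "auto \<psi> \<Longrightarrow> x \<in> A \<Longrightarrow> \<psi> (f x) = f (\<psi> x)"
  by (simp add: auto_def)

lemma auto_eq: "auto \<psi> \<Longrightarrow> x \<in> A \<Longrightarrow> y \<in> A \<Longrightarrow> \<psi> x = \<psi> y \<longleftrightarrow> x = y"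
  by (auto simp: auto_def bij_betw_def inj_on_eq_iff)

lemma auto_id: "auto id"
  by (simp add: auto_def)

lemma auto_comp: "auto \<psi> \<Longrightarrow> auto \<chi> \<Longrightarrow> auto (\<psi> \<circ> \<chi>)"
  unfolding auto_def by (auto intro: bij_betw_trans) (metis bij_betwE)

lemma auto_inv:
  assumes "auto \<psi>"
  obtains \<chi> where "auto \<chi>" "\<And>x. x \<in> A \<Longrightarrow> \<chi> (\<psi> x) = x" "\<And>x. x \<in> A \<Longrightarrow> \<psi> (\<chi> x) = x"
proof
  let ?\<chi> = "inv_into A \<psi>"
  have bij: "bij_betw \<psi> A A"
    using assms by (simp add: auto_def)
  show l: "?\<chi> (\<psi> x) = x" and r: "\<psi> (?\<chi> x) = x" if "x \<in> A" for x
    using bij that by (simp_all add: bij_betw_inv_into_left bij_betw_inv_into_right)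
  have "bij_betw ?\<chi> A A"
    using bij by (rule bij_betw_inv_into)
  moreover have "?\<chi> (f x) = f (?\<chi> x)" if "x \<in> A" for x
  proof -
    have "?\<chi> x \<in> A"
      using \<open>bij_betw ?\<chi> A A\<close> that by (meson bij_betwE)
    then show ?thesis
      using auto_f[OF assms, of "?\<chi> x"] r[OF that] l[OF closed, of "?\<chi> x"] by simp
  qed
  ultimately show "auto ?\<chi>"
    by (simp add: auto_def)
qed

lemma auto_involution:
  assumes "\<And>x. x \<in> A \<Longrightarrow> \<psi> x \<in> A" "\<And>x. x \<in> A \<Longrightarrow> \<psi> (\<psi> x) = x"
    and "\<And>x. x \<in> A \<Longrightarrow> \<psi> (f x) = f (\<psi> x)"
  shows "auto \<psi>"
  unfolding auto_def using assms by (auto intro!: bij_betw_byWitness[where f' = \<psi>])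

section \<open>Extending a partial isomorphism by one point\<close>

text \<open>Apart from the trivial case \<open>b = c\<close>, this says exactly that fixing
  \<open>B\<close> pointwise and sending \<open>b\<close> to \<open>c\<close> is injective and
  arc-preserving on \<open>insert b B\<close>.\<close>

definition one_point_swap :: "'a set \<Rightarrow> 'a \<Rightarrow> 'a \<Rightarrow> bool" where
  "one_point_swap B b c \<longleftrightarrow>
     B \<subseteq> A \<and> b \<in> A - B \<and> c \<in> A - B \<and> b \<noteq> c \<and> (f b = b \<longleftrightarrow> f c = c) \<and>
     (\<forall>x\<in>B. (f b = x \<longleftrightarrow> f c = x) \<and> (f x = b \<longleftrightarrow> f x = c))"

text \<open>If an automorphism \<open>\<psi>\<close> already agrees with \<open>\<phi>\<close> on \<open>B\<close>, then replacing \<open>\<phi>\<close> by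
  \<open>\<psi>\<inverse> \<circ> \<phi>\<close> makes it the identity on \<open>B\<close>, so a further point can be treated on its own.\<close>

lemma extends_by_one_point:
  assumes one: "\<And>B b c. one_point_swap B b c \<Longrightarrow> \<exists>\<psi>. auto \<psi> \<and> \<psi> b = c \<and> (\<forall>x\<in>B. \<psi> x = x)"
    and "finite B" "B \<subseteq> A" "inj_on \<phi> B" "\<phi> ` B \<subseteq> A" "arc_preserving B \<phi>"
  shows "\<exists>\<psi>. auto \<psi> \<and> (\<forall>x\<in>B. \<psi> x = \<phi> x)"
  using assms(2-)
proof (induction B)
  case empty
  then show ?case using auto_id by blast
next
  case (insert b B)
  have "arc_preserving B \<phi>"
    using insert.prems(4) by (simp add: arc_preserving_def)
  then obtain \<psi> where \<psi>: "auto \<psi>" "\<And>x. x \<in> B \<Longrightarrow> \<psi> x = \<phi> x"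
    using insert by auto
  obtain \<chi> where \<chi>: "auto \<chi>" "\<And>x. x \<in> A \<Longrightarrow> \<chi> (\<psi> x) = x" "\<And>x. x \<in> A \<Longrightarrow> \<psi> (\<chi> x) = x"
    using auto_inv[OF \<psi>(1)] by blast
  define c where "c = \<chi> (\<phi> b)"
  have b: "b \<in> A" "b \<notin> B" "B \<subseteq> A" "\<phi> b \<in> A" "\<phi> b \<notin> \<phi> ` B"
    using insert by auto
  have c: "c \<in> A" "\<psi> c = \<phi> b"
    using b \<chi> by (auto simp: c_def auto_in)
  have "\<psi> x = \<psi> y \<longleftrightarrow> x = y" if "x \<in> A" "y \<in> A" for x y
    using auto_eq[OF \<psi>(1)] that by blast
  \<comment> \<open>The automorphism \<open>\<psi>\<close> preserves and reflects arcs, so the arcs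
    between \<open>c\<close> and \<open>B\<close> are those between \<open>\<phi> b\<close> and the
    image of \<open>B\<close>, which \<open>\<phi>\<close> matches with the arcs at
    \<open>b\<close>.\<close>
  then have eqs: "f c = c \<longleftrightarrow> f (\<phi> b) = \<phi> b" "\<And>x. x \<in> B \<Longrightarrow> f c = x \<longleftrightarrow> f (\<phi> b) = \<phi> x"
    "\<And>x. x \<in> B \<Longrightarrow> f x = c \<longleftrightarrow> f (\<phi> x) = \<phi> b" "\<And>x. x \<in> B \<Longrightarrow> x \<noteq> c"
    using \<psi> c b auto_f closed by (metis, metis subsetD, metis subsetD, metis image_eqI)
  have "\<exists>\<psi>'. auto \<psi>' \<and> \<psi>' b = c \<and> (\<forall>x\<in>B. \<psi>' x = x)"
  proof (cases "b = c")
    case True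
    then show ?thesis using auto_id by auto
  next
    case False
    with insert.prems(4) b c eqs have "one_point_swap B b c"
      unfolding one_point_swap_def arc_preserving_def by blast
    then show ?thesis by (rule one)
  qed
  then obtain \<psi>' where \<psi>': "auto \<psi>'" "\<psi>' b = c" "\<And>x. x \<in> B \<Longrightarrow> \<psi>' x = x"
    by blast
  have "auto (\<psi> \<circ> \<psi>')"
    using \<psi>(1) \<psi>'(1) by (rule auto_comp)
  moreover have "\<forall>x\<in>insert b B. (\<psi> \<circ> \<psi>') x = \<phi> x"
    using \<psi> \<psi>' c by auto
  ultimately show ?case by blast
qed

lemma homogeneousI:
  assumes "\<And>B b c. one_point_swap B b c \<Longrightarrow> \<exists>\<psi>. auto \<psi> \<and> \<psi> b = c \<and> (\<forall>x\<in>B. \<psi> x = x)"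
  shows "homogeneous n"
  unfolding homogeneous_def using extends_by_one_point[OF assms] by blast

section \<open>Homogeneity of each kind of operation\<close>

text \<open>\<open>B\<close> avoids the components of \<open>b\<close> and \<open>c\<close>: a point
  of \<open>B\<close> that is the image of \<open>b\<close> would also be the image of
  \<open>c\<close>, and \<open>f\<close> is injective. Exchanging \<open>b\<close> with
  \<open>c\<close> and \<open>f b\<close> with \<open>f c\<close> is then an involution; if
  \<open>c = f b\<close>, it just flips one 2-cycle.\<close>

lemma homogeneous_period_2:
  assumes p: "\<And>x. x \<in> A \<Longrightarrow> f (f x) = x"
  shows "homogeneous n"
proof (rule homogeneousI)
  fix B b c assume s: "one_point_swap B b c"
  then have bc: "b \<in> A" "c \<in> A" "b \<noteq> c" "f b = b \<longleftrightarrow> f c = c"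
    by (auto simp: one_point_swap_def)
  have inj: "f x = f y \<longleftrightarrow> x = y" if "x \<in> A" "y \<in> A" for x y
    using p that by metis
  have notB: "f b \<notin> B" "f c \<notin> B" "b \<notin> B" "c \<notin> B"
    using s inj[of b c] bc unfolding one_point_swap_def by auto
  define \<psi> where "\<psi> x = (if x = b then c else if x = c then b
    else if x = f b then f c else if x = f c then f b else x)" for x
  have "auto \<psi>"
  proof (rule auto_involution)
    fix x assume x: "x \<in> A"
    show "\<psi> x \<in> A" using x bc closed by (auto simp: \<psi>_def)
    show "\<psi> (\<psi> x) = x" using x bc p inj closed by (auto simp: \<psi>_def)
    show "\<psi> (f x) = f (\<psi> x)"
      using x bc p inj closed unfolding \<psi>_def by (smt (verit))
  qed
  then show "\<exists>\<psi>. auto \<psi> \<and> \<psi> b = c \<and> (\<forall>x\<in>B. \<psi> x = x)"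
    using notB by (auto intro!: exI[of _ \<psi>] simp: \<psi>_def)
qed

text \<open>\<open>f\<close> permutes the orbit of \<open>b\<close> and no outside point enters it,
  so applying \<open>f ^^ j\<close> on the orbit and the identity elsewhere commutes with
  \<open>f\<close>. The disjunction in \<open>p\<close> serves cycles of length 3 and of length 4
  alike.\<close>

lemma auto_rotation:
  assumes p: "\<And>x. x \<in> A \<Longrightarrow> f (f (f (f x))) = x \<or> f (f (f x)) = x"
    and b: "b \<in> A" and c: "c = (f ^^ j) b"
    and notB: "b \<notin> B" "f b \<notin> B" "f (f b) \<notin> B" "f (f (f b)) \<notin> B"
  shows "\<exists>\<psi>. auto \<psi> \<and> \<psi> b = c \<and> (\<forall>x\<in>B. \<psi> x = x)"
proof -
  \<comment> \<open>The whole orbit in both cases; if the period is 3, the last entry repeats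
    \<open>b\<close>.\<close>
  define S where "S = {b, f b, f (f b), f (f (f b))}"
  have S: "S \<subseteq> A" "b \<in> S" "S \<inter> B = {}"
    using b closed notB by (auto simp: S_def)
  \<comment> \<open>By \<open>p\<close>, the point \<open>x\<close> is itself an iterate of
    \<open>f x\<close>, so \<open>S\<close> is also closed under preimages.\<close>
  have inS: "f x \<in> S \<longleftrightarrow> x \<in> S" if "x \<in> A" for x
    unfolding S_def using p[OF that] p[OF b] by (smt (verit) insertE insertCI empty_iff)
  have "inj_on f S"
    using p S by (intro inj_onI) (smt (verit) S_def insertE empty_iff closed b subsetD)
  have im: "f ` S = S"
    using inS S by (intro endo_inj_surj \<open>inj_on f S\<close>) (auto simp: S_def)
  have "bij_betw f S S"
    using im \<open>inj_on f S\<close> by (simp add: bij_betw_def)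
  then have bij: "bij_betw (f ^^ j) S S"
    by (rule bij_betw_funpow)
  define \<psi> where "\<psi> x = (if x \<in> S then (f ^^ j) x else x)" for x
  have "bij_betw \<psi> (S \<union> (A - S)) (S \<union> (A - S))"
    using bij by (intro bij_betw_combine) (auto simp: \<psi>_def bij_betw_def inj_on_def)
  then have "bij_betw \<psi> A A"
    using S by (simp add: Un_absorb1)
  moreover have "\<psi> (f x) = f (\<psi> x)" if "x \<in> A" for x
    using inS[OF that] by (simp add: \<psi>_def funpow_swap1)
  ultimately show ?thesis
    using S c by (intro exI[of _ \<psi>]) (auto simp: auto_def \<psi>_def)
qed

text \<open>Every point of the orbit of \<open>b\<close> is \<open>b\<close> or adjacent to
  \<open>b\<close>, so \<open>B\<close> avoids it, and likewise the orbit of \<open>c\<close>. A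
  transposition does not commute with a 3-cycle, hence a common orbit is rotated; two different
  orbits are exchanged in step with \<open>f\<close>.\<close>

lemma homogeneous_period_3:
  assumes p: "\<And>x. x \<in> A \<Longrightarrow> f (f (f x)) = x"
  shows "homogeneous n"
proof (rule homogeneousI)
  fix B b c assume s: "one_point_swap B b c"
  then have bc: "b \<in> A" "c \<in> A" "b \<noteq> c" "f b = b \<longleftrightarrow> f c = c"
    by (auto simp: one_point_swap_def)
  have inj: "f x = f y \<longleftrightarrow> x = y" if "x \<in> A" "y \<in> A" for x y
    using p that by metis
  have notB: "b \<notin> B" "c \<notin> B" "f b \<notin> B" "f c \<notin> B" "f (f b) \<notin> B" "f (f c) \<notin> B"
    using s p[OF bc(1)] p[OF bc(2)] inj[of b c] bc by (auto simp: one_point_swap_def)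
  show "\<exists>\<psi>. auto \<psi> \<and> \<psi> b = c \<and> (\<forall>x\<in>B. \<psi> x = x)"
  proof (cases "c = f b \<or> c = f (f b)")
    case True
    then obtain j where "c = (f ^^ j) b"
      by (auto intro: that[of 1] that[of 2] simp: numeral_2_eq_2)
    then show ?thesis
      using bc notB p by (intro auto_rotation) auto
  next
    case False
    define \<psi> where "\<psi> x = (if x = b then c else if x = c then b
      else if x = f b then f c else if x = f c then f b
      else if x = f (f b) then f (f c) else if x = f (f c) then f (f b) else x)" for x
    have ne: "c \<noteq> f b" "c \<noteq> f (f b)" "b \<noteq> f c" "b \<noteq> f (f c)" "f b \<noteq> f (f c)" "f c \<noteq> f (f b)"
      "f b \<noteq> f c" "f (f b) \<noteq> f (f c)"
      using False bc p by metis+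
    \<comment> \<open>If \<open>b\<close> and \<open>c\<close> are fixed, both orbits collapse to
      single points; these equivalences let one definition of \<open>\<psi>\<close> cover that
      case.\<close>
    have fx: "f b = f (f b) \<longleftrightarrow> f b = b" "f c = f (f c) \<longleftrightarrow> f b = b"
      "f (f b) = b \<longleftrightarrow> f b = b" "f (f c) = c \<longleftrightarrow> f b = b" "f b = b \<longleftrightarrow> f c = c"
      using bc p by metis+
    \<comment> \<open>The inverse of \<open>f\<close> is \<open>f \<circ> f\<close>, so the tests on
      \<open>f x\<close> in \<open>\<psi> (f x)\<close> become tests on \<open>x\<close>.\<close>
    have pre: "f x = b \<longleftrightarrow> x = f (f b)" "f x = c \<longleftrightarrow> x = f (f c)"
      "f x = f b \<longleftrightarrow> x = b" "f x = f c \<longleftrightarrow> x = c"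
      "f x = f (f b) \<longleftrightarrow> x = f b" "f x = f (f c) \<longleftrightarrow> x = f c" if "x \<in> A" for x
      using bc that p closed by metis+
    have "auto \<psi>"
    proof (rule auto_involution)
      fix x assume x: "x \<in> A"
      show "\<psi> x \<in> A" using x bc closed by (auto simp: \<psi>_def)
      show "\<psi> (\<psi> x) = x" using ne ne[symmetric] fx bc by (auto simp: \<psi>_def)
      show "\<psi> (f x) = f (\<psi> x)"
        unfolding \<psi>_def pre[OF x] using ne ne[symmetric] fx bc p by auto
    qed
    then show ?thesis
      using notB by (auto intro!: exI[of _ \<psi>] simp: \<psi>_def)
  qed
qed

lemma homogeneous_period_4:
  assumes p: "\<And>x. x \<in> A \<Longrightarrow> f (f (f (f x))) = x"
    and u: "\<And>x y. \<lbrakk>x \<in> A; y \<in> A; f x \<noteq> x; f y \<noteq> y\<rbrakk> \<Longrightarrow> y \<in> {x, f x, f (f x), f (f (f x))}"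
  shows "homogeneous n"
proof (rule homogeneousI)
  fix B b c assume s: "one_point_swap B b c"
  then have bc: "b \<in> A" "c \<in> A" "b \<noteq> c" "f b = b \<longleftrightarrow> f c = c"
    by (auto simp: one_point_swap_def)
  have inj: "f x = f y \<longleftrightarrow> x = y" if "x \<in> A" "y \<in> A" for x y
    using p that by metis
  show "\<exists>\<psi>. auto \<psi> \<and> \<psi> b = c \<and> (\<forall>x\<in>B. \<psi> x = x)"
  proof (cases "f b = b")
    case True
    define \<psi> where "\<psi> x = (if x = b then c else if x = c then b else x)" for x
    have "auto \<psi>"
      using bc True inj by (intro auto_involution) (auto simp: \<psi>_def closed)
    then show ?thesis
      using s by (auto intro!: exI[of _ \<psi>] simp: \<psi>_def one_point_swap_def)
  next
    case False
    then have c: "c \<in> {f b, f (f b), f (f (f b))}"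
      using u[of b c] bc by auto
    then obtain j where "c = (f ^^ j) b"
      by (auto intro: that[of 1] that[of 2] that[of 3] simp: numeral_eq_Suc)
    \<comment> \<open>Although \<open>f (f b)\<close> need not be adjacent to \<open>b\<close>,
      every point of the orbit is \<open>b\<close>, \<open>c\<close> or adjacent to one of them. A
      point of \<open>B\<close> adjacent to one is adjacent to both in the same direction, which
      forces \<open>b = c\<close>.\<close>
    moreover have "b \<notin> B" "f b \<notin> B" "f (f b) \<notin> B" "f (f (f b)) \<notin> B"
      using s c p[OF bc(1)] p[OF bc(2)] inj[of b c] bc unfolding one_point_swap_def
      by (metis DiffD2 insertE empty_iff)+
    ultimately show ?thesis
      using bc p by (intro auto_rotation) auto
  qed
qed

text \<open>The carrier splits into pairs of a fixed point and its only proper preimage. Exchanging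
  the pairs of \<open>b\<close> and \<open>c\<close> works because a map commutes with
  \<open>f\<close> once it respects the pairing and keeps fixed points fixed and the others
  non-fixed.\<close>

lemma homogeneous_paired:
  assumes p: "\<And>x. x \<in> A \<Longrightarrow> f (f x) = f x"
    and u: "\<And>c. c \<in> A \<Longrightarrow> f c = c \<Longrightarrow> \<exists>!x. x \<in> A \<and> x \<noteq> c \<and> f x = c"
  shows "homogeneous n"
proof (rule homogeneousI)
  \<comment> \<open>The partner of \<open>x\<close> in its pair: a fixed-point-free involution on
    \<open>A\<close>.\<close>
  define g where "g x = (if f x = x then THE y. y \<in> A \<and> y \<noteq> x \<and> f y = x else f x)" for x
  have g_fix: "g x \<in> A \<and> g x \<noteq> x \<and> f (g x) = x" if "x \<in> A" "f x = x" for x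
    using theI'[OF u[OF that]] that by (simp add: g_def)
  have g_unique: "g x = y" if "x \<in> A" "f x = x" "y \<in> A" "y \<noteq> x" "f y = x" for x y
    using g_fix u that by metis
  have g_non: "g x = f x" if "f x \<noteq> x" for x
    using that by (simp add: g_def)
  have g: "g x \<in> A" "g (g x) = x" "f (g x) = g x \<longleftrightarrow> f x \<noteq> x" "g x \<noteq> x" if "x \<in> A" for x
    using g_fix g_unique g_non closed p that by metis+
  have fg: "f x = (if f x = x then x else g x)" for x
    using g_non by auto
  fix B b c assume s: "one_point_swap B b c"
  then have bc: "b \<in> A" "c \<in> A" "b \<noteq> c" "f b = b \<longleftrightarrow> f c = c" "b \<notin> B" "c \<notin> B"
    by (auto simp: one_point_swap_def)
  have inj: "g x = g y \<longleftrightarrow> x = y" if "x \<in> A" "y \<in> A" for x y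
    using g that by metis
  have notB: "g b \<notin> B" "g c \<notin> B"
    using s g_fix g_non inj[of b c] bc unfolding one_point_swap_def by metis+
  \<comment> \<open>Partners differ in being fixed, whereas \<open>b\<close> and \<open>c\<close>
    agree in it, so these lie in different pairs.\<close>
  have ne: "g b \<noteq> c" "g c \<noteq> b" "g b \<noteq> b" "g c \<noteq> c" "g b \<noteq> g c"
    using g bc by metis+
  define \<psi> where "\<psi> x = (if x = b then c else if x = c then b
    else if x = g b then g c else if x = g c then g b else x)" for x
  have "auto \<psi>"
  proof (rule auto_involution)
    fix x assume x: "x \<in> A"
    show "\<psi> x \<in> A" using x bc g by (auto simp: \<psi>_def)
    show "\<psi> (\<psi> x) = x" using ne ne[symmetric] bc by (auto simp: \<psi>_def)
    have \<psi>g: "\<psi> (g x) = g (\<psi> x)"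
      using x bc g ne inj unfolding \<psi>_def by (smt (verit))
    have \<psi>fix: "f (\<psi> x) = \<psi> x \<longleftrightarrow> f x = x"
      using x bc g unfolding \<psi>_def by (smt (verit))
    show "\<psi> (f x) = f (\<psi> x)"
      using \<psi>g \<psi>fix g_non by metis
  qed
  then show "\<exists>\<psi>. auto \<psi> \<and> \<psi> b = c \<and> (\<forall>x\<in>B. \<psi> x = x)"
    using notB bc by (auto intro!: exI[of _ \<psi>] simp: \<psi>_def)
qed

lemma homogeneous_constant:
  assumes k: "k \<in> A" "\<And>x. x \<in> A \<Longrightarrow> f x = k"
  shows "homogeneous n"
proof (rule homogeneousI)
  fix B b c assume "one_point_swap B b c"
  \<comment> \<open>\<open>k\<close> is the only fixed point, and \<open>b\<close>, \<open>c\<close>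
    are distinct and both fixed or both non-fixed; so neither is \<open>k\<close>.\<close>
  then have bc: "b \<in> A" "c \<in> A" "b \<noteq> c" "b \<noteq> k" "c \<noteq> k" "b \<notin> B" "c \<notin> B"
    using k by (auto simp: one_point_swap_def)
  define \<psi> where "\<psi> x = (if x = b then c else if x = c then b else x)" for x
  have "auto \<psi>"
    using bc k by (intro auto_involution) (auto simp: \<psi>_def)
  then show "\<exists>\<psi>. auto \<psi> \<and> \<psi> b = c \<and> (\<forall>x\<in>B. \<psi> x = x)"
    using bc by (auto intro!: exI[of _ \<psi>] simp: \<psi>_def)
qed

section \<open>The five kinds of operation, described by equations\<close>

definition period_2 :: bool where
  "period_2 \<longleftrightarrow> (\<forall>x\<in>A. f (f x) = x)"

definition period_3 :: bool where
  "period_3 \<longleftrightarrow> (\<forall>x\<in>A. f (f (f x)) = x)"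

text \<open>Weaker than the shape of case (iii): the unique non-trivial cycle may be absent or have length
  \<open>2\<close>. The latter algebras belong to case (i).\<close>

definition period_4_connected :: bool where
  "period_4_connected \<longleftrightarrow> (\<forall>x\<in>A. f (f (f (f x))) = x) \<and>
     (\<forall>x\<in>A. \<forall>y\<in>A. f x \<noteq> x \<longrightarrow> f y \<noteq> y \<longrightarrow> y \<in> {x, f x, f (f x), f (f (f x))})"

text \<open>Every component is a copy of \<open>\<A>[1;1]\<close>.\<close>

definition paired :: bool where
  "paired \<longleftrightarrow> (\<forall>x\<in>A. f (f x) = f x) \<and> (\<forall>c\<in>A. f c = c \<longrightarrow> (\<exists>!x. x \<in> A \<and> x \<noteq> c \<and> f x = c))"

definition constant_op :: bool where
  "constant_op \<longleftrightarrow> (\<exists>k\<in>A. \<forall>x\<in>A. f x = k)"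

text \<open>The kinds overlap: the identity, for instance, satisfies both \<open>period_2\<close>
  and \<open>period_3\<close>.\<close>

definition classified :: bool where
  "classified \<longleftrightarrow> period_2 \<or> period_3 \<or> period_4_connected \<or> paired \<or> constant_op"

lemma classified_homogeneous: "classified \<Longrightarrow> homogeneous n"
  unfolding classified_def period_2_def period_3_def period_4_connected_def paired_def constant_op_def
  using homogeneous_period_2 homogeneous_period_3 homogeneous_period_4 homogeneous_paired
    homogeneous_constant by (elim disjE) blast+

section \<open>From 1- and 2-homogeneity to the classification\<close>

lemma homogeneous_1D:
  assumes "homogeneous 1" "a \<in> A" "c \<in> A" "f a = a \<longleftrightarrow> f c = c"
  obtains \<psi> where "auto \<psi>" "\<psi> a = c"
proof -
  have "\<exists>\<psi>. auto \<psi> \<and> (\<forall>x\<in>{a}. \<psi> x = c)"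
    using assms(2-) by (intro assms(1)[unfolded homogeneous_def, rule_format])
      (auto simp: arc_preserving_def)
  then show thesis using that by auto
qed

lemma homogeneous_2D:
  assumes "homogeneous 2" "a \<in> A" "b \<in> A" "c \<in> A" "d \<in> A" "a \<noteq> b" "c \<noteq> d"
    "f a = a \<longleftrightarrow> f c = c" "f b = b \<longleftrightarrow> f d = d" "f a = b \<longleftrightarrow> f c = d" "f b = a \<longleftrightarrow> f d = c"
  obtains \<psi> where "auto \<psi>" "\<psi> a = c" "\<psi> b = d"
proof -
  have "\<exists>\<psi>. auto \<psi> \<and> (\<forall>x\<in>{a, b}. \<psi> x = (if x = a then c else d))"
    using assms(2-) by (intro assms(1)[unfolded homogeneous_def, rule_format])
      (auto simp: arc_preserving_def)
  then show thesis using that assms(6) by auto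
qed

text \<open>A one-point partial subalgebra records only whether its point is fixed, so some
  automorphism carries \<open>x\<close> to \<open>y\<close> and each iterate of \<open>x\<close> to
  the same iterate of \<open>y\<close>. Equations and inequations between iterates thus spread from
  one non-fixed point to all.\<close>

lemma homogeneous_non_fixed_iff:
  assumes "homogeneous 1" "x \<in> A" "y \<in> A" "f x \<noteq> x" "f y \<noteq> y"
  shows "(f ^^ m) x = (f ^^ n) x \<longleftrightarrow> (f ^^ m) y = (f ^^ n) y"
proof -
  obtain \<psi> where \<psi>: "auto \<psi>" "\<psi> x = y"
    using homogeneous_1D[of x y] assms by metis
  have inA: "(f ^^ i) x \<in> A" for i
    using assms(2) closed by (induction i) auto
  have "\<psi> ((f ^^ i) x) = (f ^^ i) y" for i
    using \<psi>(2) by (induction i) (simp_all add: auto_f[OF \<psi>(1) inA])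
  then show ?thesis
    using auto_eq[OF \<psi>(1) inA inA] by metis
qed

lemma homogeneous_imp_classified_idempotent:
  assumes "homogeneous 1" "homogeneous 2" and ff: "\<And>x. x \<in> A \<Longrightarrow> f (f x) = f x"
    and x: "x \<in> A" "f x \<noteq> x"
  shows "constant_op \<or> paired"
proof (cases constant_op)
  case False
  \<comment> \<open>All fixed points are alike by 1-homogeneity, and \<open>f x\<close> is one with
    the proper preimage \<open>x\<close>.\<close>
  have ex: "\<exists>y\<in>A. y \<noteq> c \<and> f y = c" if c: "c \<in> A" "f c = c" for c
  proof -
    obtain \<psi> where "auto \<psi>" "\<psi> (f x) = c"
      using homogeneous_1D[OF assms(1), of "f x" c] c x ff closed by metis
    then show ?thesis
      using x auto_f auto_in auto_eq closed by metis
  qed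
  have uniq: "y = z" if c: "c \<in> A" "f c = c" and y: "y \<in> A" "y \<noteq> c" "f y = c"
    and z: "z \<in> A" "z \<noteq> c" "f z = c" for c y z
  proof (rule ccontr)
    assume "y \<noteq> z"
    \<comment> \<open>All values of \<open>f\<close> are fixed points, so a single fixed point would
      make \<open>f\<close> constant.\<close>
    obtain d where "d \<in> A" "f d = d" "d \<noteq> c"
      using False c ff closed unfolding constant_op_def by metis
    then obtain w where w: "w \<in> A" "w \<noteq> d" "f w = d"
      using ex by blast
    \<comment> \<open>Neither pair contains a fixed point or an arc. Since \<open>\<psi>\<close>
      fixes \<open>y\<close>, it fixes \<open>c = f y\<close>; but \<open>c = f z\<close> is sent to
      \<open>f w = d\<close>.\<close>
    obtain \<psi> where \<psi>: "auto \<psi>" "\<psi> y = y" "\<psi> z = w"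
      using \<open>y \<noteq> z\<close> \<open>d \<noteq> c\<close> \<open>f d = d\<close> y z w c
      by (elim homogeneous_2D[OF assms(2), of y z y w, rotated -1]) metis+
    then show False
      using auto_f[OF \<psi>(1)] y z w \<open>d \<noteq> c\<close> by metis
  qed
  have "paired"
    unfolding paired_def using ff ex uniq by blast
  then show ?thesis ..
qed simp

lemma homogeneous_imp_classified:
  assumes "homogeneous 1" "homogeneous 2"
  shows "classified"
proof (cases "\<exists>x\<in>A. f x \<noteq> x")
  case False
  then show ?thesis by (auto simp: classified_def period_2_def)
next
  case True
  then obtain x where x: "x \<in> A" "f x \<noteq> x" by blast
  note same = homogeneous_non_fixed_iff[OF assms(1) _ _ _ x(2)]
  show ?thesis
  proof (cases "f (f x) = f x")
    case True
    have "f (f y) = f y" if "y \<in> A" for y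
      using same[of y 2 1] x that True by (cases "f y = y") (auto simp: numeral_2_eq_2)
    then show ?thesis
      using homogeneous_imp_classified_idempotent[OF assms] x by (auto simp: classified_def)
  next
    case ne: False
    have in_A: "f x \<in> A" "f (f x) \<in> A"
      using x closed by auto
    have p2: ?thesis if "f (f x) = x"
    proof -
      have "f (f y) = y" if "y \<in> A" for y
        using same[of y 2 0] x that \<open>f (f x) = x\<close> by (cases "f y = y") (auto simp: numeral_2_eq_2)
      then show ?thesis by (simp add: classified_def period_2_def)
    qed
    have p3: ?thesis if "f (f (f x)) = x"
    proof -
      have "f (f (f y)) = y" if "y \<in> A" for y
        using same[of y 3 0] x that \<open>f (f (f x)) = x\<close>
        by (cases "f y = y") (auto simp: numeral_3_eq_3)
      then show ?thesis by (simp add: classified_def period_3_def)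
    qed
    have p4: ?thesis if n2: "f (f x) \<noteq> x" and n3: "f (f (f x)) \<noteq> x"
    proof -
      \<comment> \<open>The point \<open>f x\<close> is again non-fixed, so it inherits
        \<open>f (f x) \<noteq> f x\<close> from \<open>x\<close>.\<close>
      have nf: "f (f (f x)) \<noteq> f (f x)"
        using same[of "f x" 2 1] in_A x ne by (auto simp: numeral_2_eq_2)
      \<comment> \<open>\<open>n2\<close>, \<open>n3\<close>, \<open>ne\<close> and
        \<open>nf\<close> say that \<open>x\<close> and \<open>f (f x)\<close> are distinct,
        non-adjacent and non-fixed, so they may be interchanged.\<close>
      obtain \<psi> where \<psi>: "auto \<psi>" "\<psi> x = f (f x)" "\<psi> (f (f x)) = x"
        using x in_A n2 n3 ne nf
        by (elim homogeneous_2D[OF assms(2), of x "f (f x)" "f (f x)" x, rotated -1]) auto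
      then have x4: "f (f (f (f x))) = x"
        using auto_f[OF \<psi>(1)] x in_A by metis
      have f4: "f (f (f (f y))) = y" if "y \<in> A" for y
        using same[of y 4 0] x that x4 by (cases "f y = y") (auto simp: numeral_eq_Suc)
      have orb: "y \<in> {z, f z, f (f z), f (f (f z))}"
        if yz: "z \<in> A" "y \<in> A" "f z \<noteq> z" "f y \<noteq> y" for y z
      proof (rule ccontr)
        assume *: "\<not> ?thesis"
        have z: "f (f z) \<noteq> z" "f (f (f z)) \<noteq> z" "f (f z) \<noteq> f z" "f (f (f z)) \<noteq> f (f z)"
          using same[of z 2 0] same[of z 3 0] same[of z 2 1] same[of z 3 2] yz x n2 n3 ne nf
          by (auto simp: numeral_eq_Suc)
        have "f y \<noteq> z"
          using * f4[OF yz(2)] by auto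
        \<comment> \<open>Both pairs are non-adjacent; \<open>f y = z\<close> would give
          \<open>y = f (f (f z))\<close>. As \<open>\<psi>\<close> fixes \<open>z\<close>, it fixes
          \<open>f (f z)\<close>, which thus has the same image as \<open>y\<close>.\<close>
        then obtain \<psi> where \<psi>: "auto \<psi>" "\<psi> z = z" "\<psi> y = f (f z)"
          using yz * z closed
          by (elim homogeneous_2D[OF assms(2), of z y z "f (f z)", rotated -1]) auto
        then have "\<psi> (f (f z)) = \<psi> y"
          using auto_f[OF \<psi>(1)] yz closed by metis
        then show False
          using auto_eq[OF \<psi>(1)] yz closed * by auto
      qed
      show ?thesis
        using f4 orb unfolding classified_def period_4_connected_def by blast
    qed
    show ?thesis using p2 p3 p4 by blast
  qed
qed

end

section \<open>Translating partial subalgebras and digraphs\<close>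

lemma monounary_algebraD:
  assumes "monounary_algebra M"
  shows "unary_operation (carrier M) (oper M)" "domain M = carrier M"
  using assms by (auto simp: monounary_algebra_def unary_operation_def)

text \<open>Membership of \<open>x\<close> in the domain means that its outgoing arc stays inside
  \<open>B\<close>. Respecting domains and values therefore amounts to preserving and reflecting
  single arcs, which also describes isomorphisms of induced subdigraphs.\<close>

lemma isomorphism_partial_subalgebra_iff:
  assumes "monounary_algebra M" "B \<subseteq> carrier M" "C \<subseteq> carrier M"
  shows "isomorphism (partial_subalgebra M B) (partial_subalgebra M C) \<phi> \<longleftrightarrow>
    bij_betw \<phi> B C \<and> (\<forall>x\<in>B. \<forall>y\<in>B. oper M x = y \<longleftrightarrow> oper M (\<phi> x) = \<phi> y)"
    (is "_ \<longleftrightarrow> ?R")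
proof
  assume iso: "isomorphism (partial_subalgebra M B) (partial_subalgebra M C) \<phi>"
  then have bij: "bij_betw \<phi> B C"
    by (simp add: isomorphism_def partial_subalgebra_def)
  have D: "domain M = carrier M"
    using assms(1) by (rule monounary_algebraD)
  have dom: "oper M x \<in> B \<longleftrightarrow> oper M (\<phi> x) \<in> C" if "x \<in> B" for x
  proof -
    have "x \<in> B \<and> x \<in> domain M \<and> oper M x \<in> B \<longleftrightarrow>
        \<phi> x \<in> C \<and> \<phi> x \<in> domain M \<and> oper M (\<phi> x) \<in> C"
      using iso that by (simp add: isomorphism_def partial_subalgebra_def)
    moreover have "\<phi> x \<in> C"
      using bij that by (rule bij_betwE[THEN bspec])
    ultimately show ?thesis
      using that assms(2,3) unfolding D by blast
  qed
  have op: "\<phi> (oper M x) = oper M (\<phi> x)" if "x \<in> B" "oper M x \<in> B" for x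
  proof -
    have "x \<in> domain (partial_subalgebra M B)"
      using that assms(2) by (auto simp: partial_subalgebra_def D)
    then show ?thesis
      using iso by (simp add: isomorphism_def partial_subalgebra_def)
  qed
  \<comment> \<open>The reflecting half: an arc from \<open>\<phi> x\<close> inside \<open>C\<close>
    puts \<open>x\<close> in the domain, so \<open>\<phi> (oper M x) = \<phi> y\<close>, and
    \<open>\<phi>\<close> is injective.\<close>
  have arc: "oper M x = y" if "x \<in> B" "y \<in> B" "oper M (\<phi> x) = \<phi> y" for x y
  proof -
    have "oper M (\<phi> x) \<in> C"
      unfolding that(3) using bij that(2) by (rule bij_betwE[THEN bspec])
    then have "oper M x \<in> B"
      using dom[OF that(1)] by blast
    moreover from this have "\<phi> (oper M x) = \<phi> y"
      using op[OF that(1)] that(3) by simp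
    ultimately show ?thesis
      using bij that(2) by (metis bij_betw_imp_inj_on inj_onD)
  qed
  show ?R
  proof (intro conjI ballI iffI)
    fix x y assume "x \<in> B" "y \<in> B"
    then show "oper M (\<phi> x) = \<phi> y" if "oper M x = y"
      using op[of x] that by simp
    from \<open>x \<in> B\<close> \<open>y \<in> B\<close> show "oper M x = y" if "oper M (\<phi> x) = \<phi> y"
      using that by (rule arc)
  qed (rule bij)
next
  assume ?R
  then have bij: "bij_betw \<phi> B C"
    and arc: "\<And>x y. x \<in> B \<Longrightarrow> y \<in> B \<Longrightarrow> oper M x = y \<longleftrightarrow> oper M (\<phi> x) = \<phi> y"
    by auto
  have \<phi>_in: "\<phi> x \<in> C" if "x \<in> B" for x
    using bij that by (rule bij_betwE[THEN bspec])
  have "oper M x \<in> B" if x: "x \<in> B" "oper M (\<phi> x) \<in> C" for x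
  proof -
    obtain y where "y \<in> B" "oper M (\<phi> x) = \<phi> y"
      using x(2) bij unfolding bij_betw_def by blast
    then show ?thesis
      using arc[OF x(1), of y] x(1) by simp
  qed
  moreover have op: "oper M (\<phi> x) = \<phi> (oper M x)" if "x \<in> B" "oper M x \<in> B" for x
    using arc[OF that] by simp
  moreover have "domain M = carrier M"
    using assms(1) by (rule monounary_algebraD)
  ultimately show "isomorphism (partial_subalgebra M B) (partial_subalgebra M C) \<phi>"
    using bij \<phi>_in assms(2,3) by (auto simp: isomorphism_def partial_subalgebra_def)
qed

lemma digraph_isomorphism_induced_iff:
  assumes "monounary_algebra M" "B \<subseteq> carrier M" "C \<subseteq> carrier M"
  shows "digraph_isomorphism (induced_subdigraph (relational_form M) B)
      (induced_subdigraph (relational_form M) C) \<phi> \<longleftrightarrow>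
    bij_betw \<phi> B C \<and> (\<forall>x\<in>B. \<forall>y\<in>B. oper M x = y \<longleftrightarrow> oper M (\<phi> x) = \<phi> y)"
proof (cases "bij_betw \<phi> B C")
  case True
  then have "\<phi> x \<in> C" if "x \<in> B" for x
    using that by (meson bij_betwE)
  then show ?thesis
    using True assms unfolding digraph_isomorphism_def induced_subdigraph_def relational_form_def
    by (auto simp: monounary_algebra_def subset_iff)
qed (simp add: digraph_isomorphism_def induced_subdigraph_def)

lemma automorphism_iff:
  assumes "monounary_algebra M"
  shows "automorphism M \<psi> \<longleftrightarrow> unary_operation.auto (carrier M) (oper M) \<psi>"
  using assms monounary_algebraD[OF assms]
  by (auto simp: automorphism_def isomorphism_def unary_operation.auto_def bij_betwE)

lemma digraph_automorphism_iff:
  assumes M: "monounary_algebra M"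
  shows "digraph_automorphism (relational_form M) \<psi> \<longleftrightarrow>
    unary_operation.auto (carrier M) (oper M) \<psi>"
proof -
  interpret unary_operation "carrier M" "oper M"
    using monounary_algebraD(1)[OF M] .
  have "induced_subdigraph (relational_form M) (carrier M) = relational_form M"
    by (auto simp: induced_subdigraph_def relational_form_def)
  then have "digraph_automorphism (relational_form M) \<psi> \<longleftrightarrow>
      bij_betw \<psi> (carrier M) (carrier M) \<and> arc_preserving (carrier M) \<psi>"
    using digraph_isomorphism_induced_iff[OF M order_refl order_refl]
    by (simp add: digraph_automorphism_def arc_preserving_def)
  \<comment> \<open>On the whole carrier every point has its outgoing arc, so taking
    \<open>y\<close> to be \<open>oper M x\<close> turns preservation of arcs into
    commutation.\<close>
  also have "\<dots> \<longleftrightarrow> auto \<psi>"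
  proof
    assume "bij_betw \<psi> (carrier M) (carrier M) \<and> arc_preserving (carrier M) \<psi>"
    then show "auto \<psi>"
      using closed unfolding auto_def arc_preserving_def by metis
  next
    assume "auto \<psi>"
    then show "bij_betw \<psi> (carrier M) (carrier M) \<and> arc_preserving (carrier M) \<psi>"
      using auto_eq[of \<psi>] closed unfolding arc_preserving_def auto_def[of \<psi>] by metis
  qed
  finally show ?thesis .
qed

lemma partially_n_homogeneous_iff:
  assumes M: "monounary_algebra M" and "n \<ge> 1"
  shows "partially_n_homogeneous n M \<longleftrightarrow> unary_operation.homogeneous (carrier M) (oper M) n"
    (is "?L \<longleftrightarrow> ?R")
proof -
  interpret unary_operation "carrier M" "oper M"
    using monounary_algebraD(1)[OF M] .
  show ?thesis
  proof
    assume L: ?L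
    show ?R
      unfolding homogeneous_def
    proof (intro allI impI, elim conjE)
      fix B \<phi>
      assume B: "finite B" "card B = n" "B \<subseteq> carrier M" "inj_on \<phi> B" "\<phi> ` B \<subseteq> carrier M"
        "arc_preserving B \<phi>"
      then have "isomorphism (partial_subalgebra M B) (partial_subalgebra M (\<phi> ` B)) \<phi>"
        by (simp add: isomorphism_partial_subalgebra_iff[OF M] arc_preserving_def bij_betw_def)
      moreover have "B \<noteq> {}" "card (\<phi> ` B) = n"
        using B \<open>n \<ge> 1\<close> by (auto simp: card_image)
      ultimately show "\<exists>\<psi>. auto \<psi> \<and> (\<forall>x\<in>B. \<psi> x = \<phi> x)"
        using L[unfolded partially_n_homogeneous_def, rule_format, of B "\<phi> ` B" \<phi>] B
        by (simp add: automorphism_iff[OF M])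
    qed
  next
    assume R: ?R
    show ?L
      unfolding partially_n_homogeneous_def automorphism_iff[OF M]
    proof (intro allI impI, elim conjE)
      fix B C \<phi>
      assume B: "finite B" "card B = n" "B \<subseteq> carrier M" "C \<subseteq> carrier M"
        and iso: "isomorphism (partial_subalgebra M B) (partial_subalgebra M C) \<phi>"
      have "bij_betw \<phi> B C" "arc_preserving B \<phi>"
        using iso isomorphism_partial_subalgebra_iff[OF M B(3,4)] by (simp_all add: arc_preserving_def)
      moreover from this have "inj_on \<phi> B" "\<phi> ` B \<subseteq> carrier M"
        using B(4) by (simp_all add: bij_betw_def)
      ultimately show "\<exists>\<psi>. auto \<psi> \<and> (\<forall>x\<in>B. \<psi> x = \<phi> x)"
        using R[unfolded homogeneous_def, rule_format, of B \<phi>] B by simp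
    qed
  qed
qed

lemma obtain_list_of_length:
  assumes "finite B" "1 \<le> card B" "card B \<le> n"
  obtains xs where "set xs = B" "length xs = n"
proof -
  obtain ys where ys: "set ys = B" "distinct ys"
    using finite_distinct_list[OF assms(1)] by blast
  then have "length ys = card B"
    by (simp add: distinct_card[symmetric])
  then have "set (ys @ replicate (n - card B) (hd ys)) = B"
    "length (ys @ replicate (n - card B) (hd ys)) = n"
    using ys assms by (cases ys; auto simp: set_replicate_conv_if)+
  then show thesis by (rule that)
qed

text \<open>The entries of a list of length \<open>n\<close> may repeat, so their set can have any
  size up to \<open>n\<close>. Hence 2-ultrahomogeneity of the digraph bundles partial 1- and
  2-homogeneity.\<close>

lemma digraph_n_ultrahomogeneous_iff:
  assumes M: "monounary_algebra M"
  shows "digraph_n_ultrahomogeneous n (relational_form M) \<longleftrightarrow>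
    (\<forall>k\<in>{1..n}. unary_operation.homogeneous (carrier M) (oper M) k)" (is "?L \<longleftrightarrow> ?R")
proof -
  interpret unary_operation "carrier M" "oper M"
    using monounary_algebraD(1)[OF M] .
  have verts: "verts (relational_form M) = carrier M"
    by (simp add: relational_form_def)
  show ?thesis
  proof
    assume L: ?L
    show ?R
      unfolding homogeneous_def
    proof (intro ballI allI impI, elim conjE)
      fix k B \<phi>
      assume k: "k \<in> {1..n}"
        and B: "finite B" "card B = k" "B \<subseteq> carrier M" "inj_on \<phi> B" "\<phi> ` B \<subseteq> carrier M"
        "arc_preserving B \<phi>"
      obtain xs where xs: "set xs = B" "length xs = n"
        using obtain_list_of_length[of B n] B k by auto
      have "digraph_isomorphism (induced_subdigraph (relational_form M) B)
          (induced_subdigraph (relational_form M) (\<phi> ` B)) \<phi>"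
        using B by (simp add: digraph_isomorphism_induced_iff[OF M] arc_preserving_def bij_betw_def)
      moreover have "set (map \<phi> xs) = \<phi> ` B" "length (map \<phi> xs) = n"
        using xs by auto
      ultimately show "\<exists>\<psi>. auto \<psi> \<and> (\<forall>x\<in>B. \<psi> x = \<phi> x)"
        using L[unfolded digraph_n_ultrahomogeneous_def, rule_format, of xs "map \<phi> xs" \<phi>] B xs
        by (simp add: digraph_automorphism_iff[OF M] verts)
    qed
  next
    assume R: ?R
    show ?L
      unfolding digraph_n_ultrahomogeneous_def digraph_automorphism_iff[OF M] verts
    proof (intro allI impI, elim conjE)
      fix xs ys \<phi>
      assume xs: "length xs = n" "set xs \<subseteq> carrier M" "set ys \<subseteq> carrier M"
        and iso: "digraph_isomorphism (induced_subdigraph (relational_form M) (set xs))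
          (induced_subdigraph (relational_form M) (set ys)) \<phi>"
      have bij: "bij_betw \<phi> (set xs) (set ys)" and arc: "arc_preserving (set xs) \<phi>"
        using iso digraph_isomorphism_induced_iff[OF M xs(2,3)] by (simp_all add: arc_preserving_def)
      then have inj: "inj_on \<phi> (set xs)" and im: "\<phi> ` set xs \<subseteq> carrier M"
        using xs(3) by (simp_all add: bij_betw_def)
      show "\<exists>\<psi>. auto \<psi> \<and> (\<forall>x\<in>set xs. \<psi> x = \<phi> x)"
      \<comment> \<open>The empty list, possible only for \<open>n = 0\<close>, is outside the sizes
        in \<open>?R\<close>; the identity serves.\<close>
      proof (cases "xs = []")
        case True
        then show ?thesis using auto_id by auto
      next
        case False
        then have "card (set xs) \<in> {1..n}"
          using xs(1) card_length[of xs] by (auto simp: Suc_le_eq card_gt_0_iff)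
        then show ?thesis
          using R[unfolded homogeneous_def, rule_format, of "card (set xs)" "set xs" \<phi>]
            xs inj im arc by simp
      qed
    qed
  qed
qed

section \<open>Generated subalgebras and ultrahomogeneity\<close>

lemma generated_subset: "is_subalgebra M S \<Longrightarrow> X \<subseteq> S \<Longrightarrow> generated M X \<subseteq> S"
  by (auto simp: generated_def)

lemma subset_generated: "X \<subseteq> generated M X"
  by (auto simp: generated_def)

text \<open>Each kind has an equation sending the fourth iterate back to an earlier one, so one
  point generates at most four points.\<close>

lemma (in unary_operation) classified_pow_4:
  "classified \<Longrightarrow> x \<in> A \<Longrightarrow> f (f (f (f x))) \<in> {x, f x, f (f x), f (f (f x))}"
  unfolding classified_def period_2_def period_3_def period_4_connected_def paired_def
    constant_op_def using closed by auto

lemma finite_generated: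
  assumes M: "monounary_algebra M"
    and "unary_operation.classified (carrier M) (oper M)"
    and X: "finite X" "X \<noteq> {}" "X \<subseteq> carrier M"
  shows "finite (generated M X)" "generated M X \<subseteq> carrier M"
proof -
  interpret unary_operation "carrier M" "oper M"
    using monounary_algebraD(1)[OF M] .
  let ?f = "oper M"
  define S where "S = (\<Union>x\<in>X. {x, ?f x, ?f (?f x), ?f (?f (?f x))})"
  have S: "S \<subseteq> carrier M" "S \<noteq> {}" "X \<subseteq> S" "finite S"
    using X closed by (auto simp: S_def)
  moreover have "?f s \<in> S" if "s \<in> S" for s
    using that X classified_pow_4[OF assms(2)] unfolding S_def by blast
  ultimately have "is_subalgebra M S"
    using monounary_algebraD(2)[OF M] by (auto simp: is_subalgebra_def partial_subalgebra_def)
  then show "finite (generated M X)" "generated M X \<subseteq> carrier M"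
    using generated_subset S by (meson finite_subset, meson order_trans)
qed

text \<open>The generated subalgebras are finite, so an isomorphism between them is an instance of
  partial homogeneity at their common size, which may exceed the number \<open>n\<close> of
  generators.\<close>

lemma classified_ultrahomogeneous:
  assumes M: "monounary_algebra M"
    and cl: "unary_operation.classified (carrier M) (oper M)"
  shows "ultrahomogeneous M"
  unfolding ultrahomogeneous_def n_ultrahomogeneous_def
proof (intro allI impI, elim conjE)
  interpret unary_operation "carrier M" "oper M"
    using monounary_algebraD(1)[OF M] .
  fix n xs ys \<phi>
  let ?B = "generated M (set xs)" and ?C = "generated M (set ys)"
  assume xs: "1 \<le> n" "length xs = n" "set xs \<subseteq> carrier M" "length ys = n" "set ys \<subseteq> carrier M"
    and iso: "isomorphism (partial_subalgebra M ?B) (partial_subalgebra M ?C) \<phi>"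
  have ne: "set xs \<noteq> {}" "set ys \<noteq> {}"
    using xs by auto
  note B = finite_generated[OF M cl finite_set ne(1) xs(3)]
    and C = finite_generated[OF M cl finite_set ne(2) xs(5)]
  have "card ?B = card ?C"
    using isomorphism_partial_subalgebra_iff[OF M B(2) C(2)] iso by (blast intro: bij_betw_same_card)
  moreover have "?B \<noteq> {}" "?C \<noteq> {}"
    using ne subset_generated[of "set xs" M] subset_generated[of "set ys" M] by auto
  moreover from this have "card ?B \<ge> 1"
    using B(1) by (simp add: Suc_le_eq card_gt_0_iff)
  moreover have "partially_n_homogeneous (card ?B) M"
    using partially_n_homogeneous_iff[OF M] classified_homogeneous[OF cl] \<open>card ?B \<ge> 1\<close> by blast
  ultimately show "\<exists>\<psi>. automorphism M \<psi> \<and> (\<forall>x\<in>?B. \<psi> x = \<phi> x)"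
    using B C iso unfolding partially_n_homogeneous_def by metis
qed

section \<open>Building isomorphisms onto the listed algebras\<close>

text \<open>The witness \<open>h\<close> runs from the listed algebra \<open>N\<close> to
  \<open>M\<close>, where it can be written down by cases; its inverse is the isomorphism
  sought.\<close>

lemma isomorphicI:
  assumes M: "monounary_algebra M" and "domain N = carrier N"
    and h: "bij_betw h (carrier N) (carrier M)"
    and N: "\<And>y. y \<in> carrier N \<Longrightarrow> oper N y \<in> carrier N"
    and op: "\<And>y. y \<in> carrier N \<Longrightarrow> h (oper N y) = oper M (h y)"
  shows "isomorphic M N"
proof -
  define \<phi> where "\<phi> = inv_into (carrier N) h"
  have bij: "bij_betw \<phi> (carrier M) (carrier N)"
    unfolding \<phi>_def using h by (rule bij_betw_inv_into)
  have \<phi>_h: "\<phi> (h y) = y" if "y \<in> carrier N" for y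
    unfolding \<phi>_def using h that by (rule bij_betw_inv_into_left)
  have "\<phi> (oper M x) = oper N (\<phi> x)" if "x \<in> carrier M" for x
  proof -
    obtain y where y: "y \<in> carrier N" "x = h y"
      using h \<open>x \<in> carrier M\<close> unfolding bij_betw_def by blast
    then show ?thesis
      using \<phi>_h[OF y(1)] \<phi>_h[OF N[OF y(1)]] by (simp add: op[symmetric])
  qed
  moreover have "domain M = carrier M"
    using M by (rule monounary_algebraD)
  ultimately have "isomorphism M N \<phi>"
    using bij bij_betwE[OF bij] assms(2) by (simp add: isomorphism_def)
  then show ?thesis
    unfolding isomorphic_def by blast
qed

text \<open>The orbits partition the carrier into fixed points and cycles of exactly
  \<open>n\<close> points. \<open>I\<close> collects the fixed points, \<open>J\<close> one
  representative of each cycle, and \<open>h\<close> sends \<open>(x, i)\<close> to the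
  \<open>i\<close>-th iterate of \<open>x\<close>.\<close>

lemma isomorphic_cycles:
  fixes M :: "'a partial_monounary"
  assumes M: "monounary_algebra M" and n: "n > 0"
    and per: "\<And>x. x \<in> carrier M \<Longrightarrow> (oper M ^^ n) x = x"
    and inj: "\<And>x. x \<in> carrier M \<Longrightarrow> oper M x \<noteq> x \<Longrightarrow> inj_on (\<lambda>i. (oper M ^^ i) x) {..<n}"
  shows "\<exists>(I :: 'a set) (J :: 'a set).
    isomorphic M (disjoint_sum (copies I (cycle_algebra 1)) (copies J (cycle_algebra n)))"
proof -
  let ?f = "oper M" and ?A = "carrier M"
  interpret unary_operation ?A ?f
    using monounary_algebraD(1)[OF M] .
  have pow_in: "(?f ^^ i) x \<in> ?A" if "x \<in> ?A" for i x
    using that closed by (induction i) auto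
  have pow_mod: "(?f ^^ i) x = (?f ^^ (i mod n)) x" if "x \<in> ?A" for i x
    using funpow_mod_eq[OF per[OF that]] by simp
  define orb where "orb x = range (\<lambda>i. (?f ^^ i) x)" for x
  have orb_self: "x \<in> orb x" for x
    unfolding orb_def by (rule range_eqI[of _ _ 0]) simp
  have orb_mono: "orb y \<subseteq> orb x" if y_in: "y \<in> orb x" for x y
  proof -
    obtain i where y: "y = (?f ^^ i) x"
      using y_in by (auto simp: orb_def)
    have "(?f ^^ j) y = (?f ^^ (j + i)) x" for j
      by (simp add: y funpow_add)
    then show ?thesis
      unfolding orb_def by blast
  qed
  have orb_sym: "x \<in> orb y" if xy: "x \<in> ?A" "y \<in> orb x" for x y
  proof -
    obtain i where i: "y = (?f ^^ i) x"
      using xy(2) by (auto simp: orb_def)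
    \<comment> \<open>From \<open>y\<close>, another \<open>n * i - i\<close> steps complete a
      multiple of \<open>n\<close> and return to \<open>x\<close>; the bound keeps this difference
      of naturals exact.\<close>
    have "i \<le> n * i"
      using n by simp
    then have "(?f ^^ (n * i - i)) y = (?f ^^ (n * i)) x"
      by (simp add: i funpow_add[THEN fun_cong, unfolded comp_apply, symmetric])
    also have "\<dots> = x"
      using pow_mod[OF xy(1), of "n * i"] by simp
    finally show ?thesis
      unfolding orb_def by (metis rangeI)
  qed
  have orb_eq: "orb y = orb x" if "x \<in> ?A" "y \<in> orb x" for x y
    using orb_mono[OF that(2)] orb_mono[OF orb_sym[OF that]] by (rule equalityI)
  have orb_in: "y \<in> ?A" if "x \<in> ?A" "y \<in> orb x" for x y
    using that pow_in by (auto simp: orb_def)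
  have orb_fixed: "orb x = {x}" if "?f x = x" for x
  proof -
    have "(?f ^^ i) x = x" for i
      using that by (induction i) auto
    then show ?thesis by (simp add: orb_def)
  qed
  have fixed_iff: "?f y = y \<longleftrightarrow> ?f x = x" if "x \<in> ?A" "y \<in> orb x" for x y
    using orb_fixed orb_sym[OF that] that(2) by (metis singletonD)
  \<comment> \<open>The choice depends on the set \<open>orb x\<close> alone, so all points of an
    orbit get the same representative.\<close>
  define rep where "rep x = (SOME y. y \<in> orb x)" for x
  have rep_in: "rep x \<in> orb x" for x
    unfolding rep_def using orb_self by (rule someI)
  have rep_eq: "rep y = rep x" if "x \<in> ?A" "y \<in> orb x" for x y
    unfolding rep_def orb_eq[OF that] ..
  define I where "I = {x \<in> ?A. ?f x = x}"
  define J where "J = {x \<in> ?A. ?f x \<noteq> x \<and> rep x = x}"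
  define N where "N = disjoint_sum (copies I (cycle_algebra 1)) (copies J (cycle_algebra n))"
  define h :: "('a \<times> nat) + ('a \<times> nat) \<Rightarrow> 'a"
    where "h = case_sum fst (\<lambda>(x, i). (?f ^^ i) x)"
  have h: "h (Inl (x, k)) = x" "h (Inr (x, i)) = (?f ^^ i) x" for x k i
    by (simp_all add: h_def)
  have car: "carrier N = I \<times> {0} <+> J \<times> {..<n}" "domain N = carrier N"
    by (auto simp: N_def disjoint_sum_def copies_def cycle_algebra_def)
  have op: "oper N (Inl (x, k)) = Inl (x, 0)" "oper N (Inr (x, i)) = Inr (x, Suc i mod n)" for x k i
    by (simp_all add: N_def disjoint_sum_def copies_def cycle_algebra_def)
  have pow_orb: "(?f ^^ i) x \<in> orb x" for i x
    by (simp add: orb_def)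
  have inj_h: "inj_on h (carrier N)"
  proof (rule inj_onI)
    fix u v
    assume uv: "u \<in> carrier N" "v \<in> carrier N" "h u = h v"
    have mixed: "(?f ^^ i) y \<noteq> x" if "x \<in> I" "y \<in> J" for x y i
      using fixed_iff[OF _ pow_orb, of y i] that by (auto simp: I_def J_def)
    have cyc: "x = y \<and> i = j" if "x \<in> J" "y \<in> J" "i < n" "j < n" "(?f ^^ i) x = (?f ^^ j) y" for x y i j
    proof -
      have "rep x = rep y"
        using rep_eq[OF _ pow_orb, of x i] rep_eq[OF _ pow_orb, of y j] that by (auto simp: J_def)
      then have "x = y"
        using that by (auto simp: J_def)
      moreover from this have "i = j"
        using inj_onD[OF inj, of x i j] that by (auto simp: J_def)
      ultimately show ?thesis ..
    qed
    consider x y where "x \<in> I" "y \<in> I" "u = Inl (x, 0)" "v = Inl (y, 0)"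
      | x y i where "x \<in> I" "y \<in> J" "u = Inl (x, 0)" "v = Inr (y, i)"
      | x y i where "x \<in> I" "y \<in> J" "u = Inr (y, i)" "v = Inl (x, 0)"
      | x y i j where "x \<in> J" "y \<in> J" "i < n" "j < n" "u = Inr (x, i)" "v = Inr (y, j)"
      using uv(1,2) unfolding car(1) by blast
    then show "u = v"
    proof cases
      case 1
      then show ?thesis using uv(3) by (simp add: h)
    next
      case (2 x y i)
      then show ?thesis using uv(3) mixed[of x y i] by (simp add: h)
    next
      case (3 x y i)
      then show ?thesis using uv(3) mixed[of x y i] by (simp add: h)
    next
      case (4 x y i j)
      then show ?thesis using uv(3) cyc[of x y i j] by (simp add: h)
    qed
  qed
  have "h ` carrier N = ?A"
  proof
    show "h ` carrier N \<subseteq> ?A"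
      unfolding car(1) using pow_in by (auto simp: h I_def J_def elim!: PlusE)
    show "?A \<subseteq> h ` carrier N"
    proof
      fix y assume y: "y \<in> ?A"
      show "y \<in> h ` carrier N"
      proof (cases "?f y = y")
        case True
        then have "Inl (y, 0) \<in> carrier N"
          using y by (simp add: car(1) I_def InlI)
        then show ?thesis
          using h(1) by (metis image_eqI)
      next
        case False
        let ?x = "rep y"
        have x: "?x \<in> ?A" "y \<in> orb ?x" "rep ?x = ?x" "?f ?x \<noteq> ?x"
          using orb_in[OF y rep_in] orb_sym[OF y rep_in] rep_eq[OF y rep_in] fixed_iff[OF y rep_in]
            False by auto
        then obtain i where "y = (?f ^^ i) ?x"
          by (auto simp: orb_def)
        then have "y = h (Inr (?x, i mod n))"
          using pow_mod[OF x(1)] by (simp add: h)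
        moreover have "Inr (?x, i mod n) \<in> carrier N"
          using x n by (simp add: car(1) J_def InrI)
        ultimately show ?thesis by blast
      qed
    qed
  qed
  with inj_h have "bij_betw h (carrier N) ?A"
    by (simp add: bij_betw_def)
  moreover have step: "oper N y \<in> carrier N \<and> h (oper N y) = ?f (h y)" if "y \<in> carrier N" for y
    using that unfolding car(1)
  proof (elim PlusE)
    fix u assume "u \<in> I \<times> {0}" "y = Inl u"
    then show "oper N y \<in> (I \<times> {0} <+> J \<times> {..<n}) \<and> h (oper N y) = ?f (h y)"
      by (auto simp: op h I_def)
  next
    fix u assume "u \<in> J \<times> {..<n}" "y = Inr u"
    then obtain x i where u: "x \<in> J" "i < n" "y = Inr (x, i)"
      by auto
    have "h (oper N y) = (?f ^^ (Suc i mod n)) x"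
      unfolding u(3) op h ..
    also have "\<dots> = (?f ^^ Suc i) x"
      using u(1) by (intro pow_mod[symmetric]) (simp add: J_def)
    also have "\<dots> = ?f (h y)"
      unfolding u(3) h by simp
    finally have "h (oper N y) = ?f (h y)" .
    moreover have "oper N y \<in> (I \<times> {0} <+> J \<times> {..<n})"
      unfolding u(3) op using u(1) n by (intro InrI) simp
    ultimately show "oper N y \<in> (I \<times> {0} <+> J \<times> {..<n}) \<and> h (oper N y) = ?f (h y)"
      by (rule conjI[rotated])
  qed
  ultimately have "isomorphic M N"
    by (intro isomorphicI[OF M car(2), of h]) blast+
  then show ?thesis unfolding N_def by blast
qed

text \<open>The condition on \<open>z\<close> excludes periods 1 and 2, so its cycle has exactly
  four points, and by connectedness it contains every non-fixed point.\<close>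

lemma isomorphic_one_4_cycle:
  fixes M :: "'a partial_monounary"
  assumes M: "monounary_algebra M" and "unary_operation.period_4_connected (carrier M) (oper M)"
    and z: "z \<in> carrier M" "oper M (oper M z) \<noteq> z"
  shows "\<exists>I :: 'a set. isomorphic M (disjoint_sum (copies I (cycle_algebra 1)) (cycle_algebra 4))"
proof -
  let ?f = "oper M" and ?A = "carrier M"
  interpret unary_operation ?A ?f
    using monounary_algebraD(1)[OF M] .
  have f4: "\<And>x. x \<in> ?A \<Longrightarrow> ?f (?f (?f (?f x))) = x"
    and u: "\<And>y. y \<in> ?A \<Longrightarrow> ?f y \<noteq> y \<Longrightarrow> y \<in> {z, ?f z, ?f (?f z), ?f (?f (?f z))}"
    using assms(2) z unfolding period_4_connected_def by metis+
  have in_A: "?f z \<in> ?A" "?f (?f z) \<in> ?A" "?f (?f (?f z)) \<in> ?A"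
    using z closed by auto
  have ne: "?f z \<noteq> z" "?f (?f z) \<noteq> ?f z" "?f (?f (?f z)) \<noteq> ?f (?f z)" "?f (?f (?f z)) \<noteq> z"
    "?f (?f (?f z)) \<noteq> ?f z"
    using f4[OF z(1)] z(2) by metis+
  define I where "I = {x \<in> ?A. ?f x = x}"
  define N where "N = disjoint_sum (copies I (cycle_algebra 1)) (cycle_algebra 4)"
  define h :: "('a \<times> nat) + nat \<Rightarrow> 'a" where "h = case_sum fst (\<lambda>i. (?f ^^ i) z)"
  have less4: "{..<4} = {0, 1, 2, 3 :: nat}"
    by auto
  have car: "carrier N = I \<times> {0} <+> {0, 1, 2, 3}" "domain N = carrier N"
    by (auto simp: N_def disjoint_sum_def copies_def cycle_algebra_def less4)
  have op: "oper N (Inl (x, k)) = Inl (x, 0)" "oper N (Inr i) = Inr (Suc i mod 4)" for x k i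
    by (simp_all add: N_def disjoint_sum_def copies_def cycle_algebra_def)
  have h: "h (Inl (x, k)) = x" "h (Inr 0) = z" "h (Inr (Suc 0)) = ?f z" "h (Inr 2) = ?f (?f z)"
    "h (Inr (Suc (Suc 0))) = ?f (?f z)" "h (Inr 3) = ?f (?f (?f z))" for x k
    by (simp_all add: h_def numeral_eq_Suc)
  have "inj_on h (carrier N)"
    unfolding car(1) using ne ne[symmetric] z(2) z(2)[symmetric] f4[OF z(1)]
    by (intro inj_onI) (auto simp: h I_def elim!: PlusE)
  moreover have "h ` carrier N = ?A"
  proof
    show "h ` carrier N \<subseteq> ?A"
      unfolding car(1) using z in_A by (auto simp: h I_def elim!: PlusE)
    have "y \<in> h ` carrier N" if "y \<in> ?A" for y
    proof (cases "?f y = y")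
      case True
      then have "Inl (y, 0) \<in> carrier N"
        using that by (simp add: car(1) I_def InlI)
      then show ?thesis
        using h(1) by (metis image_eqI)
    next
      case False
      have "Inr i \<in> carrier N" if "i \<in> {0, 1, 2, 3}" for i
        using that by (simp only: car(1) InrI)
      then have "h (Inr 0) \<in> h ` carrier N" "h (Inr (Suc 0)) \<in> h ` carrier N"
        "h (Inr 2) \<in> h ` carrier N" "h (Inr 3) \<in> h ` carrier N"
        by (intro imageI; simp)+
      then show ?thesis
        using u[OF that False] unfolding h by blast
    qed
    then show "?A \<subseteq> h ` carrier N" by blast
  qed
  moreover have step: "oper N y \<in> carrier N \<and> h (oper N y) = ?f (h y)" if "y \<in> carrier N" for y
    using that unfolding car(1) by (auto simp: op h I_def f4[OF z(1)] elim!: PlusE)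
  ultimately have "bij_betw h (carrier N) ?A"
    by (simp add: bij_betw_def)
  then have "isomorphic M N"
    by (rule isomorphicI[OF M car(2)]) (use step in blast)+
  then show ?thesis unfolding N_def by blast
qed

text \<open>The copies are indexed by the fixed points \<open>c\<close>: the centre of a copy goes
  to \<open>c\<close>, its leaf to the only proper preimage \<open>g c\<close>.\<close>

lemma isomorphic_copies_star:
  fixes M :: "'a partial_monounary"
  assumes M: "monounary_algebra M" and "unary_operation.paired (carrier M) (oper M)"
  shows "\<exists>I :: 'a set. isomorphic M (copies I (star_algebra {()}))"
proof -
  let ?f = "oper M" and ?A = "carrier M"
  interpret unary_operation ?A ?f
    using monounary_algebraD(1)[OF M] .
  have ff: "\<And>x. x \<in> ?A \<Longrightarrow> ?f (?f x) = ?f x"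
    and u: "\<And>c. c \<in> ?A \<Longrightarrow> ?f c = c \<Longrightarrow> \<exists>!x. x \<in> ?A \<and> x \<noteq> c \<and> ?f x = c"
    using assms(2) unfolding paired_def by blast+
  define g where "g c = (THE x. x \<in> ?A \<and> x \<noteq> c \<and> ?f x = c)" for c
  have g: "g c \<in> ?A" "g c \<noteq> c" "?f (g c) = c" if "c \<in> ?A" "?f c = c" for c
    using theI'[OF u[OF that]] by (simp_all add: g_def)
  have g_f: "g (?f x) = x" if "x \<in> ?A" "?f x \<noteq> x" for x
    unfolding g_def using that by (intro the1_equality u closed ff) auto
  define I where "I = {x \<in> ?A. ?f x = x}"
  define N where "N = copies I (star_algebra {()})"
  define h :: "'a \<times> unit option \<Rightarrow> 'a" where "h = (\<lambda>(c, v). case v of None \<Rightarrow> c | Some _ \<Rightarrow> g c)"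
  have car: "carrier N = I \<times> {None, Some ()}" "domain N = carrier N"
    by (auto simp: N_def copies_def star_algebra_def)
  have op: "oper N (c, v) = (c, None)" for c v
    by (simp add: N_def copies_def star_algebra_def)
  have h: "h (c, None) = c" "h (c, Some ()) = g c" for c
    by (simp_all add: h_def)
  have "inj_on h (carrier N)"
    unfolding car(1) by (intro inj_onI) (auto simp: h I_def; metis g)
  moreover have "h ` carrier N = ?A"
  proof
    show "h ` carrier N \<subseteq> ?A"
      unfolding car(1) using g by (auto simp: h I_def)
    have "y \<in> h ` carrier N" if "y \<in> ?A" for y
    proof (cases "?f y = y")
      case True
      then show ?thesis
        using that h(1)[of y] by (auto simp: car(1) I_def intro!: image_eqI[of _ _ "(y, None)"])
    next
      case False
      then show ?thesis
        using that g_f ff closed h(2)[of "?f y"]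
        by (auto simp: car(1) I_def intro!: image_eqI[of _ _ "(?f y, Some ())"])
    qed
    then show "?A \<subseteq> h ` carrier N" by blast
  qed
  moreover have step: "oper N y \<in> carrier N \<and> h (oper N y) = ?f (h y)" if "y \<in> carrier N" for y
    using that g unfolding car(1) by (auto simp: op h I_def)
  ultimately have "bij_betw h (carrier N) ?A"
    by (simp add: bij_betw_def)
  then have "isomorphic M N"
    by (rule isomorphicI[OF M car(2)]) (use step in blast)+
  then show ?thesis unfolding N_def by blast
qed

lemma isomorphic_star:
  fixes M :: "'a partial_monounary"
  assumes M: "monounary_algebra M" and k: "k \<in> carrier M" "\<And>x. x \<in> carrier M \<Longrightarrow> oper M x = k"
  shows "\<exists>I :: 'a set. isomorphic M (star_algebra I)"
proof -
  let ?h = "case_option k id" and ?N = "star_algebra (carrier M - {k})"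
  have car: "carrier ?N = insert None (Some ` (carrier M - {k}))" "domain ?N = carrier ?N"
    by (simp_all add: star_algebra_def)
  have op: "oper ?N v = None" for v
    by (simp add: star_algebra_def)
  have "bij_betw ?h (carrier ?N) (carrier M)"
    unfolding car(1) bij_betw_def using k(1)
    by (auto simp: inj_on_def image_image insert_absorb)
  then have "isomorphic M ?N"
    by (rule isomorphicI[OF M car(2)]) (use k in \<open>auto simp: car(1) op\<close>)
  then show ?thesis by blast
qed

section \<open>Recovering the equations from an isomorphism\<close>

lemma isomorphicE:
  assumes "monounary_algebra M" "isomorphic M N"
  obtains \<phi> where "\<And>x. x \<in> carrier M \<Longrightarrow> \<phi> x \<in> carrier N"
    "\<And>x y. x \<in> carrier M \<Longrightarrow> y \<in> carrier M \<Longrightarrow> \<phi> x = \<phi> y \<longleftrightarrow> x = y"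
    "\<And>x. x \<in> carrier M \<Longrightarrow> \<phi> (oper M x) = oper N (\<phi> x)"
    "\<And>u. u \<in> carrier N \<Longrightarrow> \<exists>x\<in>carrier M. \<phi> x = u"
proof -
  obtain \<phi> where "isomorphism M N \<phi>"
    using assms(2) unfolding isomorphic_def by blast
  then have bij: "bij_betw \<phi> (carrier M) (carrier N)"
    and op: "\<forall>x\<in>carrier M. \<phi> (oper M x) = oper N (\<phi> x)"
    using monounary_algebraD(2)[OF assms(1)] by (simp_all add: isomorphism_def)
  show thesis
  proof
    show "\<phi> x = \<phi> y \<longleftrightarrow> x = y" if "x \<in> carrier M" "y \<in> carrier M" for x y
      using bij that unfolding bij_betw_def by (metis inj_on_eq_iff)
    show "\<exists>x\<in>carrier M. \<phi> x = u" if "u \<in> carrier N" for u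
      using bij that unfolding bij_betw_def by (metis imageE)
    show "\<phi> x \<in> carrier N" if "x \<in> carrier M" for x
      using bij that by (rule bij_betwE[THEN bspec])
    show "\<phi> (oper M x) = oper N (\<phi> x)" if "x \<in> carrier M" for x
      using op that by blast
  qed
qed

text \<open>An equation between iterates that holds in the model is pulled back along
  \<open>\<phi>\<close>, which commutes with the operations and is injective.\<close>

lemma period_2_if_isomorphic:
  assumes M: "monounary_algebra M"
    and iso: "isomorphic M (disjoint_sum (copies I (cycle_algebra 1)) (copies J (cycle_algebra 2)))"
      (is "isomorphic M ?N")
  shows "unary_operation.period_2 (carrier M) (oper M)"
proof -
  interpret unary_operation "carrier M" "oper M"
    using monounary_algebraD(1)[OF M] .
  obtain \<phi> where \<phi>: "\<And>x. x \<in> carrier M \<Longrightarrow> \<phi> x \<in> carrier ?N"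
    "\<And>x y. x \<in> carrier M \<Longrightarrow> y \<in> carrier M \<Longrightarrow> \<phi> x = \<phi> y \<longleftrightarrow> x = y"
    "\<And>x. x \<in> carrier M \<Longrightarrow> \<phi> (oper M x) = oper ?N (\<phi> x)"
    "\<And>u. u \<in> carrier ?N \<Longrightarrow> \<exists>x\<in>carrier M. \<phi> x = u"
    by (rule isomorphicE[OF M iso], rule that)
  have "oper ?N (oper ?N u) = u" if "u \<in> carrier ?N" for u
    using that by (auto simp: disjoint_sum_def copies_def cycle_algebra_def elim!: PlusE)
      (auto simp: mod_Suc less_2_cases_iff)
  then have "oper M (oper M x) = x" if "x \<in> carrier M" for x
    using that \<phi>(1)[of x] \<phi>(2)[of "oper M (oper M x)" x] by (simp add: \<phi>(3) closed)
  then show ?thesis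
    by (simp add: period_2_def)
qed

lemma period_3_if_isomorphic:
  assumes M: "monounary_algebra M"
    and iso: "isomorphic M (disjoint_sum (copies I (cycle_algebra 1)) (copies J (cycle_algebra 3)))"
      (is "isomorphic M ?N")
  shows "unary_operation.period_3 (carrier M) (oper M)"
proof -
  interpret unary_operation "carrier M" "oper M"
    using monounary_algebraD(1)[OF M] .
  obtain \<phi> where \<phi>: "\<And>x. x \<in> carrier M \<Longrightarrow> \<phi> x \<in> carrier ?N"
    "\<And>x y. x \<in> carrier M \<Longrightarrow> y \<in> carrier M \<Longrightarrow> \<phi> x = \<phi> y \<longleftrightarrow> x = y"
    "\<And>x. x \<in> carrier M \<Longrightarrow> \<phi> (oper M x) = oper ?N (\<phi> x)"
    "\<And>u. u \<in> carrier ?N \<Longrightarrow> \<exists>x\<in>carrier M. \<phi> x = u"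
    by (rule isomorphicE[OF M iso], rule that)
  have "oper ?N (oper ?N (oper ?N u)) = u" if "u \<in> carrier ?N" for u
    using that by (auto simp: disjoint_sum_def copies_def cycle_algebra_def elim!: PlusE)
      (auto simp: mod_Suc)
  then have "oper M (oper M (oper M x)) = x" if "x \<in> carrier M" for x
    using that \<phi>(1)[of x] \<phi>(2)[of "oper M (oper M (oper M x))" x] by (simp add: \<phi>(3) closed)
  then show ?thesis
    by (simp add: period_3_def)
qed

lemma period_4_connected_if_isomorphic:
  assumes M: "monounary_algebra M"
    and iso: "isomorphic M (disjoint_sum (copies I (cycle_algebra 1)) (cycle_algebra 4))"
      (is "isomorphic M ?N")
  shows "unary_operation.period_4_connected (carrier M) (oper M)"
proof -
  interpret unary_operation "carrier M" "oper M"
    using monounary_algebraD(1)[OF M] .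
  obtain \<phi> where \<phi>: "\<And>x. x \<in> carrier M \<Longrightarrow> \<phi> x \<in> carrier ?N"
    "\<And>x y. x \<in> carrier M \<Longrightarrow> y \<in> carrier M \<Longrightarrow> \<phi> x = \<phi> y \<longleftrightarrow> x = y"
    "\<And>x. x \<in> carrier M \<Longrightarrow> \<phi> (oper M x) = oper ?N (\<phi> x)"
    "\<And>u. u \<in> carrier ?N \<Longrightarrow> \<exists>x\<in>carrier M. \<phi> x = u"
    by (rule isomorphicE[OF M iso], rule that)
  let ?g = "oper ?N"
  have less4: "{..<4} = {0, 1, 2, 3 :: nat}"
    by auto
  have "?g (?g (?g (?g u))) = u" if "u \<in> carrier ?N" for u
    using that by (auto simp: disjoint_sum_def copies_def cycle_algebra_def less4 elim!: PlusE)
  then have "oper M (oper M (oper M (oper M x))) = x" if "x \<in> carrier M" for x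
    using that \<phi>(1)[of x] \<phi>(2)[of "oper M (oper M (oper M (oper M x)))" x]
    by (simp add: \<phi>(3) closed)
  moreover have conn: "v \<in> {u, ?g u, ?g (?g u), ?g (?g (?g u))}"
    if "u \<in> carrier ?N" "v \<in> carrier ?N" "?g u \<noteq> u" "?g v \<noteq> v" for u v
    using that by (auto simp: disjoint_sum_def copies_def cycle_algebra_def less4 elim!: PlusE)
  have "y \<in> {x, oper M x, oper M (oper M x), oper M (oper M (oper M x))}"
    if xy: "x \<in> carrier M" "y \<in> carrier M" "oper M x \<noteq> x" "oper M y \<noteq> y" for x y
  proof -
    have "?g (\<phi> x) \<noteq> \<phi> x" "?g (\<phi> y) \<noteq> \<phi> y"
      using xy \<phi>(2)[of "oper M x" x] \<phi>(2)[of "oper M y" y] by (simp_all add: \<phi>(3) closed)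
    then have "\<phi> y \<in> {\<phi> x, ?g (\<phi> x), ?g (?g (\<phi> x)), ?g (?g (?g (\<phi> x)))}"
      by (intro conn \<phi>(1) xy)
    \<comment> \<open>The iterates of \<open>\<phi> x\<close> are the images of the iterates of
      \<open>x\<close>, so injectivity pulls the membership back.\<close>
    then have "\<phi> y \<in> \<phi> ` {x, oper M x, oper M (oper M x), oper M (oper M (oper M x))}"
      using xy by (simp add: \<phi>(3) closed)
    then obtain w where "w \<in> {x, oper M x, oper M (oper M x), oper M (oper M (oper M x))}" "\<phi> y = \<phi> w"
      by blast
    moreover from this have "w \<in> carrier M"
      using xy closed by blast
    ultimately show ?thesis
      using \<phi>(2)[of y w] xy(2) by simp
  qed
  ultimately show ?thesis
    unfolding period_4_connected_def by blast
qed

lemma paired_if_isomorphic: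
  assumes M: "monounary_algebra M"
    and iso: "isomorphic M (copies I (star_algebra {()}))" (is "isomorphic M ?N")
  shows "unary_operation.paired (carrier M) (oper M)"
proof -
  interpret unary_operation "carrier M" "oper M"
    using monounary_algebraD(1)[OF M] .
  obtain \<phi> where \<phi>: "\<And>x. x \<in> carrier M \<Longrightarrow> \<phi> x \<in> carrier ?N"
    "\<And>x y. x \<in> carrier M \<Longrightarrow> y \<in> carrier M \<Longrightarrow> \<phi> x = \<phi> y \<longleftrightarrow> x = y"
    "\<And>x. x \<in> carrier M \<Longrightarrow> \<phi> (oper M x) = oper ?N (\<phi> x)"
    "\<And>u. u \<in> carrier ?N \<Longrightarrow> \<exists>x\<in>carrier M. \<phi> x = u"
    by (rule isomorphicE[OF M iso], rule that)
  have op: "oper ?N (i, v) = (i, None)" for i v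
    by (simp add: copies_def star_algebra_def)
  have car: "carrier ?N = I \<times> {None, Some ()}"
    by (simp add: copies_def star_algebra_def)
  have "oper M (oper M x) = oper M x" if "x \<in> carrier M" for x
    using that \<phi>(2)[of "oper M (oper M x)" "oper M x"] op[of "fst (\<phi> x)" "snd (\<phi> x)"]
    by (simp add: \<phi>(3) closed op)
  moreover have "\<exists>!x. x \<in> carrier M \<and> x \<noteq> c \<and> oper M x = c"
    if c: "c \<in> carrier M" "oper M c = c" for c
  proof -
    \<comment> \<open>Only the centres of the copies are fixed in the model.\<close>
    obtain i where i: "i \<in> I" "\<phi> c = (i, None)"
      using \<phi>(1)[OF c(1)] \<phi>(3)[OF c(1)] c(2) op unfolding car by auto
    have iff: "x \<noteq> c \<and> oper M x = c \<longleftrightarrow> \<phi> x = (i, Some ())" if "x \<in> carrier M" for x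
    proof -
      have "x \<noteq> c \<and> oper M x = c \<longleftrightarrow> \<phi> x \<noteq> (i, None) \<and> oper ?N (\<phi> x) = (i, None)"
        using \<phi>(2)[OF that c(1)] \<phi>(2)[OF closed[OF that] c(1)] \<phi>(3)[OF that] i(2) by simp
      also have "\<dots> \<longleftrightarrow> \<phi> x = (i, Some ())"
        using \<phi>(1)[OF that] op unfolding car by auto
      finally show ?thesis .
    qed
    obtain y where y: "y \<in> carrier M" "\<phi> y = (i, Some ())"
      using \<phi>(4)[of "(i, Some ())"] i(1) unfolding car by auto
    show ?thesis
    proof (rule ex1I[of _ y])
      show "y \<in> carrier M \<and> y \<noteq> c \<and> oper M y = c"
        using y iff[OF y(1)] by blast
      show "x = y" if "x \<in> carrier M \<and> x \<noteq> c \<and> oper M x = c" for x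
        using that iff[of x] \<phi>(2)[of x y] y by simp
    qed
  qed
  ultimately show ?thesis
    unfolding paired_def by blast
qed

lemma constant_op_if_isomorphic:
  assumes M: "monounary_algebra M"
    and iso: "isomorphic M (star_algebra I)" (is "isomorphic M ?N")
  shows "unary_operation.constant_op (carrier M) (oper M)"
proof -
  interpret unary_operation "carrier M" "oper M"
    using monounary_algebraD(1)[OF M] .
  obtain \<phi> where \<phi>: "\<And>x. x \<in> carrier M \<Longrightarrow> \<phi> x \<in> carrier ?N"
    "\<And>x y. x \<in> carrier M \<Longrightarrow> y \<in> carrier M \<Longrightarrow> \<phi> x = \<phi> y \<longleftrightarrow> x = y"
    "\<And>x. x \<in> carrier M \<Longrightarrow> \<phi> (oper M x) = oper ?N (\<phi> x)"
    "\<And>u. u \<in> carrier ?N \<Longrightarrow> \<exists>x\<in>carrier M. \<phi> x = u"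
    by (rule isomorphicE[OF M iso], rule that)
  obtain k where k: "k \<in> carrier M" "\<phi> k = None"
    using \<phi>(4)[of None] by (auto simp: star_algebra_def)
  have "oper ?N u = None" for u
    by (simp add: star_algebra_def)
  then have "oper M x = k" if "x \<in> carrier M" for x
    using that k \<phi>(2)[of "oper M x" k] by (simp add: \<phi>(3) closed)
  then show ?thesis
    using k(1) unfolding constant_op_def by blast
qed

section \<open>Equations and listed algebras combined\<close>

lemma classified_iff:
  fixes M :: "'a partial_monounary"
  assumes M: "monounary_algebra M"
  shows "unary_operation.classified (carrier M) (oper M) \<longleftrightarrow>
    (\<exists>(I :: 'a set) (J :: 'a set).
      isomorphic M (disjoint_sum (copies I (cycle_algebra 1)) (copies J (cycle_algebra 2)))) \<or>
    (\<exists>(I :: 'a set) (J :: 'a set).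
      isomorphic M (disjoint_sum (copies I (cycle_algebra 1)) (copies J (cycle_algebra 3)))) \<or>
    (\<exists>I :: 'a set. isomorphic M (disjoint_sum (copies I (cycle_algebra 1)) (cycle_algebra 4))) \<or>
    (\<exists>I :: 'a set. isomorphic M (copies I (star_algebra {()}))) \<or>
    (\<exists>I :: 'a set. isomorphic M (star_algebra I))"
    (is "_ \<longleftrightarrow> ?P2 \<or> ?P3 \<or> ?P4 \<or> ?P5 \<or> ?P6")
proof -
  let ?f = "oper M"
  interpret unary_operation "carrier M" ?f
    using monounary_algebraD(1)[OF M] .
  have P2: ?P2 if period_2
  proof (rule isomorphic_cycles[OF M])
    fix x assume "x \<in> carrier M"
    then show "(?f ^^ 2) x = x"
      using that by (simp add: period_2_def numeral_2_eq_2)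
    show "inj_on (\<lambda>i. (?f ^^ i) x) {..<2}" if "?f x \<noteq> x"
      using that that[symmetric] by (auto simp: inj_on_def less_2_cases_iff)
  qed simp
  have P3: ?P3 if period_3
  proof (rule isomorphic_cycles[OF M])
    fix x assume x: "x \<in> carrier M"
    then have f3: "?f (?f (?f x)) = x"
      using that by (simp add: period_3_def)
    then show "(?f ^^ 3) x = x"
      by (simp add: numeral_3_eq_3)
    show "inj_on (\<lambda>i. (?f ^^ i) x) {..<3}" if "?f x \<noteq> x"
    proof -
      \<comment> \<open>As 3 is prime, a coincidence among the three iterates would already make
        \<open>x\<close> fixed.\<close>
      have ne: "?f x \<noteq> x" "?f (?f x) \<noteq> x" "?f (?f x) \<noteq> ?f x"
        using f3 that by metis+
      have "{..<3} = {0, Suc 0, Suc (Suc 0)}"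
        by auto
      then show ?thesis
        using ne ne[symmetric] by (simp add: inj_on_def)
    qed
  qed simp
  have P4: "?P2 \<or> ?P4" if period_4_connected
  \<comment> \<open>With no genuine 4-cycle, the algebra falls under the first family; otherwise
    some \<open>z\<close> lies on one.\<close>
  proof (cases period_2)
    case True
    then show ?thesis using P2 by blast
  next
    case False
    then obtain z where "z \<in> carrier M" "?f (?f z) \<noteq> z"
      unfolding period_2_def by blast
    then show ?thesis
      using isomorphic_one_4_cycle[OF M that] by blast
  qed
  have P6: ?P6 if constant_op
    using that isomorphic_star[OF M] unfolding constant_op_def by blast
  show ?thesis
  proof
    assume classified
    then show "?P2 \<or> ?P3 \<or> ?P4 \<or> ?P5 \<or> ?P6"
      unfolding classified_def
      using P2 P3 P4 isomorphic_copies_star[OF M] P6 by (elim disjE) blast+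
  next
    assume "?P2 \<or> ?P3 \<or> ?P4 \<or> ?P5 \<or> ?P6"
    then show classified
      unfolding classified_def
      by (elim disjE exE) (blast dest: period_2_if_isomorphic[OF M] period_3_if_isomorphic[OF M]
        period_4_connected_if_isomorphic[OF M] paired_if_isomorphic[OF M]
        constant_op_if_isomorphic[OF M])+
  qed
qed

theorem theorem4p14:
  fixes \<A> :: "'a partial_monounary"
  assumes "monounary_algebra \<A>"
  shows
    "(partially_homogeneous \<A> \<longleftrightarrow>
        partially_n_homogeneous 1 \<A> \<and> partially_n_homogeneous 2 \<A>) \<and>
     (partially_homogeneous \<A> \<longleftrightarrow>
        digraph_ultrahomogeneous (relational_form \<A>)) \<and>
     (partially_homogeneous \<A> \<longleftrightarrow>
        digraph_n_ultrahomogeneous 2 (relational_form \<A>)) \<and>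
     (partially_homogeneous \<A> \<longleftrightarrow>
        (\<exists>(I :: 'a set) (J :: 'a set).
           isomorphic \<A> (disjoint_sum (copies I (cycle_algebra 1)) (copies J (cycle_algebra 2)))) \<or>
        (\<exists>(I :: 'a set) (J :: 'a set).
           isomorphic \<A> (disjoint_sum (copies I (cycle_algebra 1)) (copies J (cycle_algebra 3)))) \<or>
        (\<exists>I :: 'a set.
           isomorphic \<A> (disjoint_sum (copies I (cycle_algebra 1)) (cycle_algebra 4))) \<or>
        (\<exists>I :: 'a set. isomorphic \<A> (copies I (star_algebra {()}))) \<or>
        (\<exists>I :: 'a set. isomorphic \<A> (star_algebra I))) \<and>
     (digraph_ultrahomogeneous (relational_form \<A>) \<longrightarrow> ultrahomogeneous \<A>)"
proof -
  interpret unary_operation "carrier \<A>" "oper \<A>"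
    using monounary_algebraD(1)[OF assms] .
  note n_iff = partially_n_homogeneous_iff[OF assms]
  \<comment> \<open>Every homogeneity condition is compared with \<open>classified\<close>: each
    yields the cases 1 and 2, which suffice for it, and \<open>classified\<close> gives all
    sizes.\<close>
  have ph: "partially_homogeneous \<A> \<longleftrightarrow> classified"
    unfolding partially_homogeneous_def
    using n_iff classified_homogeneous homogeneous_imp_classified
    by (meson order_refl one_le_numeral)
  moreover have "partially_n_homogeneous 1 \<A> \<and> partially_n_homogeneous 2 \<A> \<longleftrightarrow> classified"
    using n_iff[of 1] n_iff[of 2] classified_homogeneous homogeneous_imp_classified by auto
  moreover have d2: "digraph_n_ultrahomogeneous 2 (relational_form \<A>) \<longleftrightarrow> classified"
    unfolding digraph_n_ultrahomogeneous_iff[OF assms]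
    using classified_homogeneous homogeneous_imp_classified by auto
  moreover have "digraph_ultrahomogeneous (relational_form \<A>) \<longleftrightarrow> classified"
  proof
    assume "digraph_ultrahomogeneous (relational_form \<A>)"
    then show classified
      using d2 by (simp add: digraph_ultrahomogeneous_def)
  next
    assume classified
    then show "digraph_ultrahomogeneous (relational_form \<A>)"
      using classified_homogeneous
      by (simp add: digraph_ultrahomogeneous_def digraph_n_ultrahomogeneous_iff[OF assms])
  qed
  ultimately show ?thesis
    using classified_iff[OF assms] classified_ultrahomogeneous[OF assms] by argo
qed

end
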